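(* Let $I$ be an ideal in a polynomial ring $R=\mathsf{k}[x_1,\dots,x_n]$ over a field $\mathsf{k}$ with $q\ge 1$ minimal square-free monomial generators $m_1,\dots,m_q$. The following hold: (1) if $q\ge 4$, $r\ge 2$ and $\psi_I(g(r,q))\notin I^r$, then $\overline{I^r}\neq I^r$; (2) if $q\le 3$, then $I$ is a normal ideal; (3) if $q=4$, then $\overline{I^2}=I^2+(\psi_I(g(2,4)))$; (4) if $q\in\{4,5\}$, then $I$ is normal if and only if $\overline{I^r}=I^r$ for all $2\le r\le q-2$; (5) if $q=4$, then the following are equivalent: (a) $I$ is a normal ideal; (b) $\psi_I(g(2,4))\in I^2$; (c) $\psi_I(y_{\{i,j\}})=1$ for some $1\le i<j\le 4$; (d) $\gcd(m_a,m_b)\mid\mathrm{lcm}(m_c,m_d)$ for some $a,b,c,d$ with $\{a,b,c,d\}=\{1,2,3,4\}$.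
   Context: Let $[q]=\{1,\dots,q\}$ and $S_{[q]}=\mathsf{k}[y_A : \emptyset\neq A\subseteq[q]]$. For $i\in[q]$ set $\epsilon_i=\prod_{A\subseteq[q],\, i\in A}y_A\in S_{[q]}$. $\psi_I\colon S_{[q]}\to R$ is the $\mathsf{k}$-algebra homomorphism with $\psi_I(y_A)$ equal to the product of all variables $x_k$ ($k\in[n]$) such that for every $j\in[q]$: $x_k\mid m_j \iff j\in A$ (empty product $=1$). For $r\ge 2$, $q\ge 4$, $$g(r,q)=\Big(\prod_{A\subseteq[q],\,|A|\ge 1}y_A\Big)\Big(\prod_{A\subseteq[q],\,|A|\ge 3}y_A\Big)\epsilon_1^{\,r-2}\in S_{[q]}.$$ $\overline{J}$ denotes the integral closure of an ideal $J$ in its polynomial ring. An ideal $I$ is normal if $\overline{I^r}=I^r$ for all $r\ge 1$. *)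

theory Defs
  imports Complex_Main "HOL-Library.Poly_Mapping"
begin

section \<open>Polynomials\<close>

text \<open>The type \<open>('x, 'k) mpoly\<close> is the polynomial ring over \<open>'k\<close> with one variable for each
  element of \<open>'x\<close>. A monomial is represented by its exponent vector, of type \<open>'x \<Rightarrow>\<^sub>0 nat\<close>.\<close>

type_synonym ('x, 'k) mpoly = "('x \<Rightarrow>\<^sub>0 nat) \<Rightarrow>\<^sub>0 'k"

abbreviation monom :: "('x \<Rightarrow>\<^sub>0 nat) \<Rightarrow> ('x, 'k::comm_ring_1) mpoly" where
  "monom e \<equiv> Poly_Mapping.single e 1"

abbreviation Const :: "'k::comm_ring_1 \<Rightarrow> ('x, 'k) mpoly" where
  "Const c \<equiv> Poly_Mapping.single 0 c"

definition Var :: "'x \<Rightarrow> ('x, 'k::comm_ring_1) mpoly" where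
  "Var x = monom (Poly_Mapping.single x 1)"

definition squarefree_exp :: "('x \<Rightarrow>\<^sub>0 nat) \<Rightarrow> bool" where
  "squarefree_exp e \<longleftrightarrow> (\<forall>x. Poly_Mapping.lookup e x \<le> 1)"

lift_definition exp_gcd :: "('x \<Rightarrow>\<^sub>0 nat) \<Rightarrow> ('x \<Rightarrow>\<^sub>0 nat) \<Rightarrow> ('x \<Rightarrow>\<^sub>0 nat)"
  is "\<lambda>s t x. min (s x) (t x)"
  by (rule finite_subset) auto

lift_definition exp_lcm :: "('x \<Rightarrow>\<^sub>0 nat) \<Rightarrow> ('x \<Rightarrow>\<^sub>0 nat) \<Rightarrow> ('x \<Rightarrow>\<^sub>0 nat)"
  is "\<lambda>s t x. max (s x) (t x)"
proof -
  fix s t :: "'x \<Rightarrow> nat"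
  assume "finite {x. s x \<noteq> 0}" "finite {x. t x \<noteq> 0}"
  then have "finite ({x. s x \<noteq> 0} \<union> {x. t x \<noteq> 0})" by simp
  then show "finite {x. max (s x) (t x) \<noteq> 0}" by (rule rev_finite_subset) auto
qed

lemma monom_dvd_monom_iff:
  "(monom s :: ('x, 'k::field) mpoly) dvd monom t \<longleftrightarrow> (\<forall>x. Poly_Mapping.lookup s x \<le> Poly_Mapping.lookup t x)"
proof
  assume "(monom s :: ('x, 'k) mpoly) dvd monom t"
  then obtain p :: "('x, 'k) mpoly" where p: "monom t = monom s * p" ..
  have "t \<in> Poly_Mapping.keys (monom s * p)"
    unfolding p [symmetric] by simp
  then obtain u where "t = s + u"
    using keys_mult [of "monom s" p] by auto
  then show "\<forall>x. Poly_Mapping.lookup s x \<le> Poly_Mapping.lookup t x"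
    by (simp add: lookup_add)
next
  assume le: "\<forall>x. Poly_Mapping.lookup s x \<le> Poly_Mapping.lookup t x"
  have "t = s + (t - s)"
    by (rule poly_mapping_eqI) (use le in \<open>simp add: lookup_add lookup_minus\<close>)
  then have "monom t = (monom s * monom (t - s) :: ('x, 'k) mpoly)"
    by (simp add: mult_single)
  then show "(monom s :: ('x, 'k) mpoly) dvd monom t" by (rule dvdI)
qed

lemma Var_dvd_monom_iff:
  "(Var x :: ('x, 'k::field) mpoly) dvd monom e \<longleftrightarrow> Poly_Mapping.lookup e x \<noteq> 0"
  unfolding Var_def monom_dvd_monom_iff by (auto simp: lookup_single when_def Suc_le_eq)

text \<open>The \<open>'k\<close>-algebra homomorphism sending each variable \<open>v\<close> to \<open>f v\<close>.\<close>

definition poly_subst ::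
    "('v \<Rightarrow> ('x, 'k::comm_ring_1) mpoly) \<Rightarrow> ('v, 'k) mpoly \<Rightarrow> ('x, 'k) mpoly" where
  "poly_subst f p = (\<Sum>e\<in>Poly_Mapping.keys p. Const (Poly_Mapping.lookup p e) * (\<Prod>v\<in>Poly_Mapping.keys e. f v ^ Poly_Mapping.lookup e v))"

lemma poly_subst_superset:
  assumes "finite E" "Poly_Mapping.keys p \<subseteq> E"
  shows "poly_subst f p = (\<Sum>e\<in>E. Const (Poly_Mapping.lookup p e) * (\<Prod>v\<in>Poly_Mapping.keys e. f v ^ Poly_Mapping.lookup e v))"
  unfolding poly_subst_def
  by (rule sum.mono_neutral_left) (use assms in \<open>auto simp: in_keys_iff\<close>)

lemma poly_subst_single:
  "poly_subst f (Poly_Mapping.single e c) = Const c * (\<Prod>v\<in>Poly_Mapping.keys e. f v ^ Poly_Mapping.lookup e v)"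
  by (subst poly_subst_superset [of "{e}"]) auto

lemma poly_subst_Const: "poly_subst f (Const c) = Const c"
  by (simp add: poly_subst_single)

lemma poly_subst_Var: "poly_subst f (Var v) = f v"
  by (simp add: Var_def poly_subst_single)

lemma poly_subst_add: "poly_subst f (p + q) = poly_subst f p + poly_subst f q"
proof -
  let ?E = "Poly_Mapping.keys p \<union> Poly_Mapping.keys q"
  have "Poly_Mapping.keys (p + q) \<subseteq> ?E" by (rule keys_add)
  then show ?thesis
    by (simp add: poly_subst_superset [of ?E] lookup_add single_add distrib_right sum.distrib)
qed

lemma poly_subst_sum: "poly_subst f (sum h A) = (\<Sum>a\<in>A. poly_subst f (h a))"
  by (induction A rule: infinite_finite_induct) 
    (simp_all add: poly_subst_add, simp_all add: poly_subst_def)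

lemma poly_subst_single_mult:
  fixes f :: "'v \<Rightarrow> ('x, 'k::comm_ring_1) mpoly"
  shows "poly_subst f (Poly_Mapping.single d a * Poly_Mapping.single e b) =
    poly_subst f (Poly_Mapping.single d a) * poly_subst f (Poly_Mapping.single e b)"
proof -
  let ?K = "Poly_Mapping.keys d \<union> Poly_Mapping.keys e"
  have *: "(\<Prod>v\<in>Poly_Mapping.keys h. f v ^ Poly_Mapping.lookup h v) = (\<Prod>v\<in>?K. f v ^ Poly_Mapping.lookup h v)"
    if "Poly_Mapping.keys h \<subseteq> ?K" for h
    by (rule prod.mono_neutral_left) (use that in \<open>auto simp: in_keys_iff\<close>)
  have "(\<Prod>v\<in>Poly_Mapping.keys (d + e). f v ^ Poly_Mapping.lookup (d + e) v)
      = (\<Prod>v\<in>Poly_Mapping.keys d. f v ^ Poly_Mapping.lookup d v) * (\<Prod>v\<in>Poly_Mapping.keys e. f v ^ Poly_Mapping.lookup e v)"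
    unfolding * [OF keys_add] * [OF Un_upper1] * [OF Un_upper2]
    by (simp add: lookup_add power_add prod.distrib)
  moreover have "(Const (a * b) :: ('x, 'k) mpoly) = Const a * Const b"
    by (simp add: mult_single)
  ultimately show ?thesis
    by (simp only: mult_single [of d a e b] poly_subst_single) (simp only: mult_ac)
qed

lemma poly_eq_sum_single:
  "p = (\<Sum>e\<in>Poly_Mapping.keys p. Poly_Mapping.single e (Poly_Mapping.lookup p e))"
proof (rule poly_mapping_eqI)
  fix k
  show "Poly_Mapping.lookup p k = Poly_Mapping.lookup
      (\<Sum>e\<in>Poly_Mapping.keys p. Poly_Mapping.single e (Poly_Mapping.lookup p e)) k"
    by (simp add: lookup_sum lookup_single when_def in_keys_iff)
qed

lemma poly_subst_mult: "poly_subst f (p * q) = poly_subst f p * poly_subst f q"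
proof -
  let ?s = "\<lambda>p e. Poly_Mapping.single e (Poly_Mapping.lookup p e)"
  have "p * q = (\<Sum>d\<in>Poly_Mapping.keys p. ?s p d) * (\<Sum>e\<in>Poly_Mapping.keys q. ?s q e)"
    by (rule arg_cong2 [where f = "(*)"]) (rule poly_eq_sum_single)+
  also have "\<dots> = (\<Sum>d\<in>Poly_Mapping.keys p. \<Sum>e\<in>Poly_Mapping.keys q. ?s p d * ?s q e)"
    by (rule sum_product)
  finally have "p * q = \<dots>" .
  then have "poly_subst f (p * q)
      = (\<Sum>d\<in>Poly_Mapping.keys p. \<Sum>e\<in>Poly_Mapping.keys q. poly_subst f (?s p d) * poly_subst f (?s q e))"
    by (simp only: poly_subst_sum poly_subst_single_mult)
  also have "\<dots> = poly_subst f (\<Sum>d\<in>Poly_Mapping.keys p. ?s p d) * poly_subst f (\<Sum>e\<in>Poly_Mapping.keys q. ?s q e)"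
    by (simp only: poly_subst_sum sum_product)
  finally show ?thesis by (simp only: poly_eq_sum_single [symmetric])
qed


section \<open>Ideals\<close>

definition ideal_gen :: "'a::comm_ring_1 set \<Rightarrow> 'a set" where
  "ideal_gen G = module.span (*) G"

lemma module_times: "module ((*) :: 'a::comm_ring_1 \<Rightarrow> 'a \<Rightarrow> 'a)"
  by standard (auto simp: algebra_simps)

definition ideal_sum :: "'a::comm_ring_1 set \<Rightarrow> 'a set \<Rightarrow> 'a set" where
  "ideal_sum I J = {a + b | a b. a \<in> I \<and> b \<in> J}"

definition ideal_prod :: "'a::comm_ring_1 set \<Rightarrow> 'a set \<Rightarrow> 'a set" where
  "ideal_prod I J = ideal_gen {a * b | a b. a \<in> I \<and> b \<in> J}"

primrec ideal_power :: "'a::comm_ring_1 set \<Rightarrow> nat \<Rightarrow> 'a set" where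
  "ideal_power I 0 = UNIV"
| "ideal_power I (Suc r) = ideal_prod I (ideal_power I r)"

definition integral_closure :: "'a::comm_ring_1 set \<Rightarrow> 'a set" where
  "integral_closure J = {x. \<exists>n\<ge>1. \<exists>a. (\<forall>i\<in>{1..n}. a i \<in> ideal_power J i) \<and>
      x ^ n + (\<Sum>i=1..n. a i * x ^ (n - i)) = 0}"

definition normal_ideal :: "'a::comm_ring_1 set \<Rightarrow> bool" where
  "normal_ideal I \<longleftrightarrow> (\<forall>r\<ge>1. integral_closure (ideal_power I r) = ideal_power I r)"

text \<open>The monomials with exponents \<open>m 1, \<dots>, m q\<close> are pairwise distinct and form an
  irredundant generating set of \<open>I\<close>.\<close>

definition minimal_monomial_generators ::
    "('x, 'k::field) mpoly set \<Rightarrow> nat \<Rightarrow> (nat \<Rightarrow> 'x \<Rightarrow>\<^sub>0 nat) \<Rightarrow> bool" where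
  "minimal_monomial_generators I q m \<longleftrightarrow>
     inj_on m {1..q} \<and>
     ideal_gen ((\<lambda>j. monom (m j)) ` {1..q}) = I \<and>
     (\<forall>H. H \<subset> (\<lambda>j. monom (m j)) ` {1..q} \<longrightarrow> ideal_gen H \<noteq> I)"


section \<open>The ring \<open>S\<^bsub>[q]\<^esub>\<close> and the homomorphism \<open>\<psi>\<^sub>I\<close>\<close>

text \<open>The variables \<open>y\<^sub>A\<close> are indexed by arbitrary sets of naturals, and \<open>S_ring q\<close> is the subring
  of polynomials that involve only \<open>y\<^sub>A\<close> with \<open>\<emptyset> \<noteq> A \<subseteq> [q]\<close>.\<close>

definition S_ring :: "nat \<Rightarrow> (nat set, 'k::comm_ring_1) mpoly set" where
  "S_ring q = {p. \<forall>e\<in>Poly_Mapping.keys p. Poly_Mapping.keys e \<subseteq> Pow {1..q} - {{}}}"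

abbreviation y_var :: "nat set \<Rightarrow> (nat set, 'k::comm_ring_1) mpoly" where
  "y_var A \<equiv> Var A"

definition eps :: "nat \<Rightarrow> nat \<Rightarrow> (nat set, 'k::comm_ring_1) mpoly" where
  "eps q i = (\<Prod>A | A \<subseteq> {1..q} \<and> i \<in> A. y_var A)"

definition g_elem :: "nat \<Rightarrow> nat \<Rightarrow> (nat set, 'k::comm_ring_1) mpoly" where
  "g_elem r q = (\<Prod>A | A \<subseteq> {1..q} \<and> card A \<ge> 1. y_var A)
         * (\<Prod>A | A \<subseteq> {1..q} \<and> card A \<ge> 3. y_var A) * eps q 1 ^ (r - 2)"

text \<open>\<open>psi q m\<close> is \<open>\<psi>\<^sub>I\<close> for the ideal \<open>I\<close> generated by the monomials \<open>m 1, \<dots>, m q\<close>; only its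
  values on \<open>S_ring q\<close> are meaningful.\<close>

definition psi :: "nat \<Rightarrow> (nat \<Rightarrow> 'n::finite \<Rightarrow>\<^sub>0 nat) \<Rightarrow>
    (nat set, 'k::field) mpoly \<Rightarrow> ('n, 'k) mpoly" where
  "psi q m = poly_subst (\<lambda>A.
     \<Prod>k | \<forall>j\<in>{1..q}. (Var k :: ('n, 'k) mpoly) dvd monom (m j) \<longleftrightarrow> j \<in> A. Var k)"

lemma S_mult: "p \<in> S_ring q \<Longrightarrow> p' \<in> S_ring q \<Longrightarrow> p * p' \<in> S_ring q"
proof -
  assume p: "p \<in> S_ring q" and p': "p' \<in> S_ring q"
  show "p * p' \<in> S_ring q"
    unfolding S_ring_def
  proof (intro CollectI ballI)
    fix e assume "e \<in> Poly_Mapping.keys (p * p')"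
    then obtain d d' where "d \<in> Poly_Mapping.keys p" "d' \<in> Poly_Mapping.keys p'" "e = d + d'"
      using keys_mult [of p p'] by blast
    moreover have "Poly_Mapping.keys (d + d') \<subseteq> Poly_Mapping.keys d \<union> Poly_Mapping.keys d'"
      by (rule keys_add)
    ultimately show "Poly_Mapping.keys e \<subseteq> Pow {1..q} - {{}}"
      using p p' unfolding S_ring_def by blast
  qed
qed

lemma S_one: "1 \<in> S_ring q"
  by (simp add: S_ring_def)

lemma S_prod: "(\<And>a. a \<in> A \<Longrightarrow> h a \<in> S_ring q) \<Longrightarrow> prod h A \<in> S_ring q"
  by (induction A rule: infinite_finite_induct) (auto intro: S_one S_mult)

lemma S_power: "p \<in> S_ring q \<Longrightarrow> p ^ r \<in> S_ring q"
  by (induction r) (auto intro: S_one S_mult)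

lemma y_var_in_S: "A \<subseteq> {1..q} \<Longrightarrow> A \<noteq> {} \<Longrightarrow> y_var A \<in> S_ring q"
  by (simp add: S_ring_def Var_def)

lemma g_elem_in_S: "g_elem r q \<in> S_ring q"
  unfolding g_elem_def eps_def by (intro S_mult S_prod S_power y_var_in_S) auto

end

theory Submission
  imports "HOL-Analysis.Analysis" Defs
begin

text \<open>
  The ideal is monomial, so everything can be decided on exponents. A monomial \<open>x\<^sup>e\<close> lies in \<open>I\<^sup>r\<close> if
  and only if there are multiplicities \<open>\<mu> j\<close> with sum \<open>r\<close> and \<open>\<Sum>j. \<mu> j * m j \<le> e\<close>; it is integral over
  \<open>I\<^sup>r\<close> if and only if there are nonnegative real weights \<open>l j\<close> with these properties, that is, if \<open>e\<close>
  lies in the dilated Newton polyhedron. One direction (\<open>add_newton_monom_in_closure\<close>) turns the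
  weights into integral ones for a multiple of \<open>e\<close> by simultaneous Dirichlet approximation. The other
  (\<open>keys_integral_closure_newton\<close>) separates an exponent from the polyhedron by a hyperplane and
  compares lowest terms in an equation of integral dependence. Thus \<open>I\<^sup>r\<close> is integrally closed if and
  only if real weights of sum \<open>r\<close> can always be replaced by integral ones.

  In that problem the integral parts of the weights can be split off, which leaves weights in
  \<open>[0, 1)\<close> with integral sum. As the generators are square-free, the variable \<open>x\<^sub>k\<close> imposes only the
  condition that the sum of the multiplicities over the generators divisible by \<open>x\<^sub>k\<close> is at most \<open>e k\<close>.
  If the remaining sum is at most 1, or one less than the number of positive weights, then integral
  weights can be written down directly (\<open>fractional_power_exp\<close>). Hence only the exponents \<open>r\<close> with
  \<open>2 \<le> r \<le> q - 2\<close> can obstruct normality (\<open>newton_imp_power_exp_by_reduction\<close>), for every \<open>q\<close>; this gives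
  normality for \<open>q \<le> 3\<close> and the criterion for \<open>q \<in> {4, 5}\<close>.

  The monomial \<open>\<psi>\<^sub>I(g(r, q))\<close> is integral over \<open>I\<^sup>r\<close>, by weights \<open>1/2\<close> on four generators. For \<open>q = 4\<close> the
  only case left by the reduction is \<open>r = 2\<close> with all four weights strictly between 0 and 1, and there
  rounding up the conditions shows that \<open>x\<^sup>e\<close> is divisible by \<open>\<psi>\<^sub>I(g(2, 4))\<close> (\<open>g_exp_le\<close>). So \<open>\<psi>\<^sub>I(g(2, 4))\<close>
  generates the integral closure of \<open>I\<^sup>2\<close> modulo \<open>I\<^sup>2\<close>. It lies in \<open>I\<^sup>2\<close> precisely when some product
  \<open>m\<^sub>i m\<^sub>j\<close> with \<open>i \<noteq> j\<close> divides it, that is, when no variable divides \<open>m\<^sub>i\<close> and \<open>m\<^sub>j\<close> only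
  (\<open>power_exp_g_exp_iff\<close>), and this is also what the condition on gcd and lcm says.
\<close>

section \<open>Powers of a monomial ideal\<close>

text \<open>The condition that \<open>x\<^sup>e\<close> is divisible by a product of \<open>r\<close> generators, where the generator \<open>m j\<close>
  occurs \<open>\<mu> j\<close> times.\<close>

definition power_exp :: "nat \<Rightarrow> (nat \<Rightarrow> 'x \<Rightarrow>\<^sub>0 nat) \<Rightarrow> nat \<Rightarrow> ('x \<Rightarrow>\<^sub>0 nat) \<Rightarrow> bool" where
  "power_exp q m r e \<longleftrightarrow> (\<exists>\<mu>. (\<Sum>j\<in>{1..q}. \<mu> j) = r \<and>
     (\<forall>k. (\<Sum>j\<in>{1..q}. \<mu> j * Poly_Mapping.lookup (m j) k) \<le> Poly_Mapping.lookup e k))"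

definition monomial_power :: "nat \<Rightarrow> (nat \<Rightarrow> 'x \<Rightarrow>\<^sub>0 nat) \<Rightarrow> nat \<Rightarrow> ('x, 'k::field) mpoly set" where
  "monomial_power q m r = {p. \<forall>e\<in>Poly_Mapping.keys p. power_exp q m r e}"

lemma power_exp_0: "power_exp q m 0 e"
  unfolding power_exp_def by (intro exI [of _ "\<lambda>_. 0"]) simp

lemma power_exp_add:
  assumes "power_exp q m r d" "power_exp q m s e"
  shows "power_exp q m (r + s) (d + e)"
proof -
  obtain \<mu> \<nu> where "(\<Sum>j\<in>{1..q}. \<mu> j) = r" "(\<Sum>j\<in>{1..q}. \<nu> j) = s"
    "\<And>k. (\<Sum>j\<in>{1..q}. \<mu> j * Poly_Mapping.lookup (m j) k) \<le> Poly_Mapping.lookup d k"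
    "\<And>k. (\<Sum>j\<in>{1..q}. \<nu> j * Poly_Mapping.lookup (m j) k) \<le> Poly_Mapping.lookup e k"
    using assms unfolding power_exp_def by blast
  then show ?thesis
    unfolding power_exp_def
    by (intro exI [of _ "\<lambda>j. \<mu> j + \<nu> j"])
       (auto simp: sum.distrib algebra_simps lookup_add intro: add_mono)
qed

text \<open>A product of \<open>r + s\<close> generators contains a product of \<open>r\<close> of them: choose them one at a time
  among those whose multiplicity is not yet used up.\<close>

lemma power_exp_split:
  assumes "power_exp q m (r + s) e"
  obtains d d' where "e = d + d'" "power_exp q m r d" "power_exp q m s d'"
proof -
  have split: "\<exists>\<nu>. (\<forall>j. \<nu> j \<le> \<mu> j) \<and> (\<Sum>j\<in>{1..q}. \<nu> j) = r"
    if "(\<Sum>j\<in>{1..q}. \<mu> j) = r + s" for \<mu> :: "nat \<Rightarrow> nat" and r s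
    using that
  proof (induction r arbitrary: s)
    case 0
    show ?case by (intro exI [of _ "\<lambda>_. 0"]) simp
  next
    case (Suc r)
    obtain \<nu> where \<nu>: "\<And>j. \<nu> j \<le> \<mu> j" "(\<Sum>j\<in>{1..q}. \<nu> j) = r"
      using Suc.IH [of "Suc s"] Suc.prems by auto
    have "\<exists>i\<in>{1..q}. \<nu> i < \<mu> i"
    proof (rule ccontr)
      assume "\<not> ?thesis"
      then have "(\<Sum>j\<in>{1..q}. \<mu> j) \<le> (\<Sum>j\<in>{1..q}. \<nu> j)"
        by (intro sum_mono) (auto simp: not_less)
      with \<nu> Suc.prems show False by simp
    qed
    then obtain i where i: "i \<in> {1..q}" "\<nu> i < \<mu> i" by blast
    have "(\<Sum>j\<in>{1..q}. (\<nu>(i := Suc (\<nu> i))) j) = Suc r"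
      using i \<nu>(2) by (simp add: sum.remove [of _ i])
    with \<nu>(1) i show ?case
      by (intro exI [of _ "\<nu>(i := Suc (\<nu> i))"]) auto
  qed
  obtain \<mu> where \<mu>: "(\<Sum>j\<in>{1..q}. \<mu> j) = r + s"
    "\<And>k. (\<Sum>j\<in>{1..q}. \<mu> j * Poly_Mapping.lookup (m j) k) \<le> Poly_Mapping.lookup e k"
    using assms unfolding power_exp_def by blast
  obtain \<nu> where \<nu>: "\<And>j. \<nu> j \<le> \<mu> j" "(\<Sum>j\<in>{1..q}. \<nu> j) = r"
    using split [OF \<mu>(1)] by blast
  define d where "d = (\<Sum>j\<in>{1..q}. \<Sum>i<\<nu> j. m j)"
  have d: "Poly_Mapping.lookup d k = (\<Sum>j\<in>{1..q}. \<nu> j * Poly_Mapping.lookup (m j) k)" for k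
    by (simp add: d_def lookup_sum)
  have diff: "(\<Sum>j\<in>{1..q}. (\<mu> j - \<nu> j) * Poly_Mapping.lookup (m j) k) +
    Poly_Mapping.lookup d k = (\<Sum>j\<in>{1..q}. \<mu> j * Poly_Mapping.lookup (m j) k)" for k
    unfolding d sum.distrib [symmetric] distrib_right [symmetric] using \<nu>(1) by simp
  show ?thesis
  proof
    show "e = d + (e - d)"
      by (rule poly_mapping_eqI)
        (use diff \<mu>(2) in \<open>metis (no_types, lifting) add_leD2 le_add_diff_inverse lookup_add lookup_minus\<close>)
    show "power_exp q m r d"
      unfolding power_exp_def using \<nu> d by (intro exI [of _ \<nu>]) simp
    have "(\<Sum>j\<in>{1..q}. \<mu> j - \<nu> j) + r = r + s"
      unfolding \<nu>(2) [symmetric] \<mu>(1) [unfolded \<nu>(2) [symmetric], symmetric] sum.distrib [symmetric]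
      using \<nu>(1) by simp
    then have "(\<Sum>j\<in>{1..q}. \<mu> j - \<nu> j) = s" by simp
    moreover have "(\<Sum>j\<in>{1..q}. (\<mu> j - \<nu> j) * Poly_Mapping.lookup (m j) k)
        \<le> Poly_Mapping.lookup (e - d) k" for k
      using diff [of k] \<mu>(2) [of k] by (simp add: lookup_minus)
    ultimately show "power_exp q m s (e - d)"
      unfolding power_exp_def by (intro exI [of _ "\<lambda>j. \<mu> j - \<nu> j"]) simp
  qed
qed

lemma power_exp_mono:
  "power_exp q m r e \<Longrightarrow> power_exp q m r (e + d)"
  using power_exp_add [OF _ power_exp_0, of q m r e d] by simp

lemma monomial_power_zero: "0 \<in> monomial_power q m r"
  by (simp add: monomial_power_def)

lemma monomial_power_add:
  "a \<in> monomial_power q m r \<Longrightarrow> b \<in> monomial_power q m r \<Longrightarrow> a + b \<in> monomial_power q m r"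
  using keys_add [of a b] by (auto simp: monomial_power_def)

lemma monomial_power_uminus: "a \<in> monomial_power q m r \<Longrightarrow> - a \<in> monomial_power q m r"
  by (auto simp: monomial_power_def in_keys_iff)

lemma monomial_power_mult:
  assumes "a \<in> monomial_power q m r" "b \<in> monomial_power q m s"
  shows "a * b \<in> monomial_power q m (r + s)"
proof -
  have "power_exp q m (r + s) u" if "u \<in> Poly_Mapping.keys (a * b)" for u
    using keys_mult [of a b] that assms by (auto simp: monomial_power_def intro: power_exp_add)
  then show ?thesis by (simp add: monomial_power_def)
qed

lemma monomial_power_0: "monomial_power q m 0 = UNIV"
  by (simp add: monomial_power_def power_exp_0)

lemma monomial_power_scale: "a \<in> monomial_power q m r \<Longrightarrow> c * a \<in> monomial_power q m r"
  using monomial_power_mult [of c q m 0 a r] by (simp add: monomial_power_0)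

lemma monomial_power_sum:
  "(\<And>i. i \<in> A \<Longrightarrow> h i \<in> monomial_power q m r) \<Longrightarrow> sum h A \<in> monomial_power q m r"
  by (induction A rule: infinite_finite_induct) (auto simp: monomial_power_zero monomial_power_add)

lemma monomial_power_pow: "a \<in> monomial_power q m r \<Longrightarrow> a ^ i \<in> monomial_power q m (r * i)"
  by (induction i) (auto simp: monomial_power_0 monomial_power_mult)

lemma single_in_monomial_power_iff:
  "Poly_Mapping.single e c \<in> monomial_power q m r \<longleftrightarrow> c = 0 \<or> power_exp q m r e"
  by (simp add: monomial_power_def)

lemma ideal_gen_subset_monomial_power:
  assumes "G \<subseteq> monomial_power q m r"
  shows "ideal_gen G \<subseteq> monomial_power q m r"
  unfolding ideal_gen_def
  by (rule module.span_minimal [OF module_times assms])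
    (auto simp: module.subspace_def [OF module_times] monomial_power_zero monomial_power_add monomial_power_scale)

lemma monomial_power_subset_ideal_gen:
  assumes "\<And>e c. power_exp q m r e \<Longrightarrow> Poly_Mapping.single e c \<in> ideal_gen G"
  shows "monomial_power q m r \<subseteq> ideal_gen G"
proof
  fix p :: "('a, 'b) mpoly" assume "p \<in> monomial_power q m r"
  then have "(\<Sum>e\<in>Poly_Mapping.keys p. Poly_Mapping.single e (Poly_Mapping.lookup p e)) \<in> ideal_gen G"
    using assms unfolding ideal_gen_def
    by (intro module.span_sum [OF module_times]) (simp add: monomial_power_def)
  then show "p \<in> ideal_gen G" by (simp flip: poly_eq_sum_single)
qed

lemma ideal_prod_monomial_power:
  "ideal_prod (monomial_power q m r) (monomial_power q m s) = (monomial_power q m (r + s) :: ('x, 'k::field) mpoly set)"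
proof
  show "ideal_prod (monomial_power q m r) (monomial_power q m s) \<subseteq> (monomial_power q m (r + s) :: ('x, 'k) mpoly set)"
    unfolding ideal_prod_def by (rule ideal_gen_subset_monomial_power) (auto intro: monomial_power_mult)
  show "(monomial_power q m (r + s) :: ('x, 'k) mpoly set) \<subseteq> ideal_prod (monomial_power q m r) (monomial_power q m s)"
    unfolding ideal_prod_def
  proof (rule monomial_power_subset_ideal_gen)
    fix e and c :: 'k assume "power_exp q m (r + s) e"
    then obtain d d' where "e = d + d'" "power_exp q m r d" "power_exp q m s d'"
      by (rule power_exp_split)
    then have "Poly_Mapping.single e c = Poly_Mapping.single d c * Poly_Mapping.single d' 1"
      "Poly_Mapping.single d c \<in> monomial_power q m r" "monom d' \<in> (monomial_power q m s :: ('x, 'k) mpoly set)"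
      by (simp_all add: mult_single single_in_monomial_power_iff)
    then show "Poly_Mapping.single e c \<in> ideal_gen {a * b |a b. a \<in> monomial_power q m r \<and> b \<in> monomial_power q m s}"
      unfolding ideal_gen_def by (intro module.span_base [OF module_times]) auto
  qed
qed

lemma ideal_power_monomial_power:
  "ideal_power (monomial_power q m r) i = monomial_power q m (r * i)"
  by (induction i) (simp_all add: monomial_power_0 ideal_prod_monomial_power)

lemma power_exp_generator:
  assumes "j \<in> {1..q}"
  shows "power_exp q m 1 (m j)"
  unfolding power_exp_def
proof (intro exI conjI allI)
  show "(\<Sum>i\<in>{1..q}. of_bool (i = j)) = (1::nat)"
    using assms by (simp add: of_bool_def sum.delta)
  show "(\<Sum>i\<in>{1..q}. of_bool (i = j) * Poly_Mapping.lookup (m i) k) \<le> Poly_Mapping.lookup (m j) k" for k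
    using assms by (simp add: of_bool_def if_distrib [where f = "\<lambda>x. x * _"] sum.delta cong: if_cong)
qed

lemma ideal_gen_monom_eq_monomial_power:
  "ideal_gen ((\<lambda>j. monom (m j)) ` {1..q}) = (monomial_power q m 1 :: ('x, 'k::field) mpoly set)"
proof
  show "ideal_gen ((\<lambda>j. monom (m j)) ` {1..q}) \<subseteq> (monomial_power q m 1 :: ('x, 'k) mpoly set)"
    by (rule ideal_gen_subset_monomial_power) (auto simp: single_in_monomial_power_iff power_exp_generator simp del: One_nat_def)
  show "(monomial_power q m 1 :: ('x, 'k) mpoly set) \<subseteq> ideal_gen ((\<lambda>j. monom (m j)) ` {1..q})"
  proof (rule monomial_power_subset_ideal_gen)
    fix e and c :: 'k assume "power_exp q m 1 e"
    then obtain \<mu> where \<mu>: "(\<Sum>j\<in>{1..q}. \<mu> j) = 1"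
      "\<And>k. (\<Sum>j\<in>{1..q}. \<mu> j * Poly_Mapping.lookup (m j) k) \<le> Poly_Mapping.lookup e k"
      unfolding power_exp_def by blast
    obtain j where j: "j \<in> {1..q}" "\<mu> j \<noteq> 0"
      using \<mu>(1) by (metis sum.neutral zero_neq_one)
    have "Poly_Mapping.lookup (m j) k \<le> Poly_Mapping.lookup e k" for k
    proof -
      have "Poly_Mapping.lookup (m j) k \<le> \<mu> j * Poly_Mapping.lookup (m j) k" using j by simp
      also have "\<dots> \<le> (\<Sum>j\<in>{1..q}. \<mu> j * Poly_Mapping.lookup (m j) k)"
        using j by (intro member_le_sum) auto
      finally show ?thesis using \<mu>(2) le_trans by blast
    qed
    then have "e = (e - m j) + m j"
      by (intro poly_mapping_eqI) (simp add: lookup_add lookup_minus)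
    then have "Poly_Mapping.single e c = Poly_Mapping.single (e - m j) c * monom (m j)"
      by (simp add: mult_single)
    then show "Poly_Mapping.single e c \<in> ideal_gen ((\<lambda>j. monom (m j)) ` {1..q})"
      unfolding ideal_gen_def using j
      by (simp only:) (blast intro: module.span_scale [OF module_times] module.span_base [OF module_times])
  qed
qed

text \<open>This reduces membership in the powers of \<open>I\<close> to a condition on exponents alone.\<close>

theorem ideal_power_eq_monomial_power:
  "ideal_power (ideal_gen ((\<lambda>j. monom (m j)) ` {1..q})) r = monomial_power q m r"
  unfolding ideal_gen_monom_eq_monomial_power by (simp add: ideal_power_monomial_power)

section \<open>Integral closure and the Newton polyhedron\<close>

text \<open>The relaxation of \<^const>\<open>power_exp\<close> to real multiplicities: \<open>e\<close> lies in the \<open>r\<close>-fold dilation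
  of the Newton polyhedron, the Minkowski sum of the convex hull of the generators and the
  nonnegative orthant.\<close>

definition newton :: "nat \<Rightarrow> (nat \<Rightarrow> 'x \<Rightarrow>\<^sub>0 nat) \<Rightarrow> nat \<Rightarrow> ('x \<Rightarrow>\<^sub>0 nat) \<Rightarrow> bool" where
  "newton q m r e \<longleftrightarrow> (\<exists>l::nat \<Rightarrow> real. (\<forall>j\<in>{1..q}. 0 \<le> l j) \<and> (\<Sum>j\<in>{1..q}. l j) = real r \<and>
     (\<forall>k. (\<Sum>j\<in>{1..q}. l j * real (Poly_Mapping.lookup (m j) k)) \<le> real (Poly_Mapping.lookup e k)))"

abbreviation exp_mult :: "nat \<Rightarrow> ('x \<Rightarrow>\<^sub>0 nat) \<Rightarrow> 'x \<Rightarrow>\<^sub>0 nat" where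
  "exp_mult n e \<equiv> (\<Sum>_<n. e)"

lemma lookup_exp_mult: "Poly_Mapping.lookup (exp_mult n e) k = n * Poly_Mapping.lookup e k"
  by (simp add: lookup_sum)

lemma monom_power: "(monom e :: ('x, 'k::field) mpoly) ^ n = monom (exp_mult n e)"
  by (induction n) (simp_all add: mult_single add.commute)

text \<open>The weights \<open>l\<close> may be irrational, so clearing denominators is not enough. Simultaneous Dirichlet
  approximation gives \<open>n \<ge> 1\<close> and integers \<open>p j\<close> so close to \<open>n * l j\<close> that every relevant integer
  combination of the \<open>p j\<close> differs by less than 1 from the same combination of the \<open>n * l j\<close>.
  As both sides of \<open>\<Sum>j. p j * m j \<le> n * e\<close> are integers, an error below 1 does no harm.\<close>

lemma newton_imp_power_exp_multiple:
  fixes m :: "nat \<Rightarrow> 'x::finite \<Rightarrow>\<^sub>0 nat"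
  assumes "newton q m r e"
  obtains n where "n \<ge> 1" "power_exp q m (r * n) (exp_mult n e)"
proof -
  obtain l :: "nat \<Rightarrow> real" where l: "\<And>j. j \<in> {1..q} \<Longrightarrow> 0 \<le> l j"
      "(\<Sum>j\<in>{1..q}. l j) = real r"
      "\<And>k. (\<Sum>j\<in>{1..q}. l j * real (Poly_Mapping.lookup (m j) k)) \<le> real (Poly_Mapping.lookup e k)"
    using assms unfolding newton_def by blast
  \<comment> \<open>The bound \<open>q + S\<close> covers the coefficient vectors of all combinations used: the constant one
    for the degree, and one for each variable.\<close>
  define S where "S = (\<Sum>j\<in>{1..q}. \<Sum>k\<in>UNIV. Poly_Mapping.lookup (m j) k)"
  define N where "N = q + S + 1"
  have "N > 0" by (simp add: N_def)
  from Dirichlet_approx_simult [OF this, where \<theta> = l and n = "Suc q"]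
  obtain n p where n: "0 < n" and p: "\<And>j. j < Suc q \<Longrightarrow> \<bar>real_of_int n * l j - of_int (p j)\<bar> < 1 / N"
    by metis
  have close: "\<bar>real_of_int n * (\<Sum>j\<in>{1..q}. l j * real (c j)) - of_int (\<Sum>j\<in>{1..q}. p j * int (c j))\<bar> < 1"
    if "(\<Sum>j\<in>{1..q}. c j) \<le> q + S" for c :: "nat \<Rightarrow> nat"
  proof -
    have "real_of_int n * (\<Sum>j\<in>{1..q}. l j * real (c j)) - of_int (\<Sum>j\<in>{1..q}. p j * int (c j))
        = (\<Sum>j\<in>{1..q}. (real_of_int n * l j - of_int (p j)) * real (c j))"
      by (simp add: sum_distrib_left left_diff_distrib sum_subtractf mult.assoc)
    also have "\<bar>\<dots>\<bar> \<le> (\<Sum>j\<in>{1..q}. \<bar>real_of_int n * l j - of_int (p j)\<bar> * real (c j))"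
      by (rule order_trans [OF sum_abs]) (simp add: abs_mult)
    also have "\<dots> \<le> (\<Sum>j\<in>{1..q}. 1 / N * real (c j))"
      using p by (intro sum_mono mult_right_mono) (auto intro: less_imp_le)
    also have "\<dots> = real (\<Sum>j\<in>{1..q}. c j) / N"
      by (simp add: sum_divide_distrib)
    also have "\<dots> \<le> real (q + S) / N"
      using that by (intro divide_right_mono) (simp_all flip: of_nat_sum)
    also have "\<dots> < 1" by (simp add: N_def)
    finally show ?thesis .
  qed
  have p_ge: "0 \<le> p j" if "j \<in> {1..q}" for j
  proof -
    have "0 \<le> real_of_int n * l j" using n l(1) [OF that] by simp
    moreover have "1 / N \<le> 1" by (simp add: N_def)
    ultimately have "real_of_int (p j) > - 1" using p [of j] that by simp
    then show ?thesis by simp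
  qed
  have p_sum: "(\<Sum>j\<in>{1..q}. p j) = n * int r"
  proof -
    have "\<bar>real_of_int (n * int r - (\<Sum>j\<in>{1..q}. p j))\<bar> < 1"
      using close [of "\<lambda>_. 1"] l(2) by simp
    then have "\<bar>n * int r - (\<Sum>j\<in>{1..q}. p j)\<bar> < 1"
      by (metis of_int_abs of_int_less_1_iff)
    then show ?thesis by linarith
  qed
  have p_le: "(\<Sum>j\<in>{1..q}. p j * int (Poly_Mapping.lookup (m j) k)) \<le> n * int (Poly_Mapping.lookup e k)" for k
  proof -
    have "(\<Sum>j\<in>{1..q}. Poly_Mapping.lookup (m j) k) \<le> S"
      unfolding S_def by (intro sum_mono member_le_sum) auto
    then have "\<bar>real_of_int n * (\<Sum>j\<in>{1..q}. l j * real (Poly_Mapping.lookup (m j) k)) -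
        of_int (\<Sum>j\<in>{1..q}. p j * int (Poly_Mapping.lookup (m j) k))\<bar> < 1"
      by (intro close) simp
    moreover have "real_of_int n * (\<Sum>j\<in>{1..q}. l j * real (Poly_Mapping.lookup (m j) k))
        \<le> real_of_int n * real (Poly_Mapping.lookup e k)"
      using n l(3) by (intro mult_left_mono) auto
    ultimately have "real_of_int (\<Sum>j\<in>{1..q}. p j * int (Poly_Mapping.lookup (m j) k))
        < real_of_int (n * int (Poly_Mapping.lookup e k) + 1)"
      by simp
    then show ?thesis by linarith
  qed
  show ?thesis
  proof
    show "nat n \<ge> 1" using n by simp
    have "int (\<Sum>j\<in>{1..q}. nat (p j)) = int (r * nat n)"
      using p_ge p_sum n by (simp add: mult.commute)
    moreover have "int (\<Sum>j\<in>{1..q}. nat (p j) * Poly_Mapping.lookup (m j) k)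
        \<le> int (Poly_Mapping.lookup (exp_mult (nat n) e) k)" for k
      using p_ge p_le [of k] n unfolding lookup_exp_mult by simp
    ultimately show "power_exp q m (r * nat n) (exp_mult (nat n) e)"
      unfolding power_exp_def by (intro exI [of _ "\<lambda>j. nat (p j)"]) (simp only: of_nat_eq_iff of_nat_le_iff simp_thms)
  qed
qed

text \<open>If the \<open>n\<close>-th power of \<open>x\<^sup>e\<close> lies in the \<open>n\<close>-th power of the ideal, then \<open>z = a + b x\<^sup>e\<close> satisfies
  \<open>(z - a)\<^sup>n - (b x\<^sup>e)\<^sup>n = 0\<close>, and the binomial expansion is an equation of integral dependence.\<close>

lemma add_newton_monom_in_closure:
  fixes m :: "nat \<Rightarrow> 'x::finite \<Rightarrow>\<^sub>0 nat" and a b :: "('x, 'k::field) mpoly"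
  assumes "newton q m r e" "a \<in> monomial_power q m r"
  shows "a + b * monom e \<in> integral_closure (monomial_power q m r)"
proof -
  obtain n where n: "n \<ge> 1" "power_exp q m (r * n) (exp_mult n e)"
    using newton_imp_power_exp_multiple [OF assms(1)] .
  let ?x = "a + b * monom e"
  define c where "c i = of_nat (n choose i) * (- a) ^ i - (if i = n then (b * monom e) ^ n else 0)" for i
  have bn: "(b * monom e) ^ n \<in> monomial_power q m (r * n)"
    using n by (simp add: power_mult_distrib monom_power monomial_power_scale single_in_monomial_power_iff)
  have "c i \<in> monomial_power q m (r * i)" for i
  proof -
    have "of_nat (n choose i) * (- a) ^ i \<in> monomial_power q m (r * i)"
      by (intro monomial_power_scale monomial_power_pow monomial_power_uminus assms)
    then show ?thesis
      using bn monomial_power_add [OF _ monomial_power_uminus, of _ q m "r * i"] by (auto simp: c_def)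
  qed
  moreover have "?x ^ n + (\<Sum>i=1..n. c i * ?x ^ (n - i)) = 0"
  proof -
    have "(b * monom e) ^ n = (- a + ?x) ^ n" by simp
    also have "\<dots> = (\<Sum>i\<le>n. of_nat (n choose i) * (- a) ^ i * ?x ^ (n - i))"
      by (rule binomial_ring)
    also have "{..n} = insert 0 {1..n}" by auto
    also have "(\<Sum>i\<in>insert 0 {1..n}. of_nat (n choose i) * (- a) ^ i * ?x ^ (n - i))
        = ?x ^ n + (\<Sum>i=1..n. of_nat (n choose i) * (- a) ^ i * ?x ^ (n - i))"
      by (subst sum.insert) auto
    finally have "?x ^ n + (\<Sum>i=1..n. of_nat (n choose i) * (- a) ^ i * ?x ^ (n - i)) = (b * monom e) ^ n"
      by simp
    moreover have "(\<Sum>i=1..n. (if i = n then (b * monom e) ^ n else 0) * ?x ^ (n - i)) = (b * monom e) ^ n"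
      using n by (simp add: if_distrib [where f = "\<lambda>x. x * _"] sum.delta cong: if_cong)
    ultimately show ?thesis
      by (simp only: c_def left_diff_distrib sum_subtractf) (simp only: diff_conv_add_uminus add.assoc [symmetric] add.right_inverse)
  qed
  ultimately show ?thesis
    unfolding integral_closure_def ideal_power_monomial_power using n(1) by blast
qed

text \<open>The leading-term argument for an arbitrary translation-invariant strict order \<open>R\<close> on exponents:
  if \<open>e\<close> is the least exponent of \<open>p\<close>, then \<open>n e\<close> is a sum of \<open>n\<close> exponents of \<open>p\<close> in only one way,
  so it survives in \<open>p\<^sup>n\<close>.\<close>

lemma least_key_power:
  fixes p :: "('x, 'k::field) mpoly"
  assumes trans: "\<And>a b c. R a b \<Longrightarrow> R b c \<Longrightarrow> R a c"
    and irrefl: "\<And>a. \<not> R a a"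
    and add: "\<And>a b c. R a b \<Longrightarrow> R (a + c) (b + c)"
    and e: "e \<in> Poly_Mapping.keys p"
    and least: "\<And>u. u \<in> Poly_Mapping.keys p \<Longrightarrow> u = e \<or> R e u"
  shows "exp_mult n e \<in> Poly_Mapping.keys (p ^ n)
    \<and> (\<forall>u\<in>Poly_Mapping.keys (p ^ n). u = exp_mult n e \<or> R (exp_mult n e) u)"
proof (induction n)
  case 0
  show ?case by simp
next
  case (Suc n)
  let ?d = "exp_mult n e"
  have add2: "x + y = d + d' \<and> x = d \<and> y = d' \<or> R (d + d') (x + y) \<and> x + y \<noteq> d + d'"
    if "x = d \<or> R d x" "y = d' \<or> R d' y" for x y d d'
  proof -
    have left: "R (d + y) (x + y)" if "R d x" using add [OF that] .
    have right: "R (d + d') (d + y)" if "R d' y" using add [OF that, of d] by (simp add: add.commute)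
    have "R (d + d') (x + y) \<or> x = d \<and> y = d'"
      using that left right trans by blast
    then show ?thesis using irrefl by metis
  qed
  have keys: "u = ?d + e \<or> R (?d + e) u" if u: "u \<in> Poly_Mapping.keys (p ^ n * p)" for u
  proof -
    obtain x y where "u = x + y" "x \<in> Poly_Mapping.keys (p ^ n)" "y \<in> Poly_Mapping.keys p"
      using keys_mult [of "p ^ n" p] u by auto
    then show ?thesis using add2 [of x ?d y e] Suc.IH least by blast
  qed
  let ?a = "Poly_Mapping.lookup (p ^ n) ?d" and ?b = "Poly_Mapping.lookup p e"
  let ?s = "Poly_Mapping.single ?d ?a" and ?t = "Poly_Mapping.single e ?b"
  define f where "f = p ^ n - ?s"
  define g where "g = p - ?t"
  have f: "x \<in> Poly_Mapping.keys (p ^ n) \<and> x \<noteq> ?d" if "x \<in> Poly_Mapping.keys f" for x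
    using that by (auto simp: f_def in_keys_iff lookup_minus lookup_single when_def split: if_splits)
  have g: "x \<in> Poly_Mapping.keys p \<and> x \<noteq> e" if "x \<in> Poly_Mapping.keys g" for x
    using that by (auto simp: g_def in_keys_iff lookup_minus lookup_single when_def split: if_splits)
  have "p ^ n * p = ?s * ?t + f * p + ?s * g"
    by (simp add: f_def g_def algebra_simps)
  moreover have "Poly_Mapping.lookup (f * p) (?d + e) = 0"
  proof (rule ccontr)
    assume "\<not> ?thesis"
    then have "?d + e \<in> Poly_Mapping.keys (f * p)" by (simp add: in_keys_iff)
    then obtain x y where "?d + e = x + y" "x \<in> Poly_Mapping.keys f" "y \<in> Poly_Mapping.keys p"
      using keys_mult [of f p] by auto
    then show False using add2 [of x ?d y e] f [of x] Suc.IH least by metis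
  qed
  moreover have "Poly_Mapping.lookup (?s * g) (?d + e) = 0"
  proof (rule ccontr)
    assume "\<not> ?thesis"
    then have "?d + e \<in> Poly_Mapping.keys (?s * g)" by (simp add: in_keys_iff)
    then obtain x y where "?d + e = x + y" "x \<in> Poly_Mapping.keys ?s" "y \<in> Poly_Mapping.keys g"
      using keys_mult [of ?s g] by auto
    then show False using g [of y] by (auto split: if_splits)
  qed
  ultimately have "Poly_Mapping.lookup (p ^ n * p) (?d + e) = ?a * ?b"
    by (simp add: lookup_add mult_single)
  moreover have "?a * ?b \<noteq> 0" using Suc.IH e by (simp add: in_keys_iff)
  ultimately have "?d + e \<in> Poly_Mapping.keys (p ^ n * p)" by (simp add: in_keys_iff)
  with keys show ?case by (simp add: mult.commute)
qed

text \<open>The dilated Newton polyhedron is the sum of a compact and a closed convex set, hence closed and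
  convex, and a hyperplane separates an exponent outside it. For a product of \<open>r i\<close> generators, the
  vector \<open>u / i\<close> lies in the polyhedron, so one bound \<open>b\<close> serves all \<open>i\<close>.\<close>

lemma newton_separation:
  fixes m :: "nat \<Rightarrow> 'x::finite \<Rightarrow>\<^sub>0 nat"
  assumes "\<not> newton q m r e"
  obtains w :: "'x \<Rightarrow> real" and b where
    "(\<Sum>k\<in>UNIV. w k * real (Poly_Mapping.lookup e k)) < b"
    "\<And>i u. i \<ge> 1 \<Longrightarrow> power_exp q m (r * i) u \<Longrightarrow>
       real i * b < (\<Sum>k\<in>UNIV. w k * real (Poly_Mapping.lookup u k))"
proof -
  have r: "r > 0"
  proof (rule ccontr)
    assume "\<not> r > 0"
    then have "newton q m r e"
      unfolding newton_def by (intro exI [of _ "\<lambda>_. 0"]) simp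
    with assms show False ..
  qed
  define vec :: "('x \<Rightarrow>\<^sub>0 nat) \<Rightarrow> real ^ 'x" where "vec u = (\<chi> k. real (Poly_Mapping.lookup u k))" for u
  define K where "K = convex hull ((\<lambda>j. real r *\<^sub>R vec (m j)) ` {1..q})"
  define C where "C = {y :: real ^ 'x. \<forall>k. 0 \<le> y $ k}"
  define P where "P = (\<Union>x\<in>K. \<Union>y\<in>C. {x + y})"
  define L where "L = {x. \<exists>l. (\<forall>j\<in>{1..q}. 0 \<le> l j) \<and> (\<Sum>j\<in>{1..q}. l j) = real r \<and>
    (\<Sum>j\<in>{1..q}. l j *\<^sub>R vec (m j)) = x}"
  have "convex L"
  proof (rule convexI)
    fix x y and s t :: real
    assume "x \<in> L" "y \<in> L" and st: "0 \<le> s" "0 \<le> t" "s + t = 1"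
    then obtain l l' where l: "\<forall>j\<in>{1..q}. 0 \<le> l j" "(\<Sum>j\<in>{1..q}. l j) = real r"
        "(\<Sum>j\<in>{1..q}. l j *\<^sub>R vec (m j)) = x"
      and l': "\<forall>j\<in>{1..q}. 0 \<le> l' j" "(\<Sum>j\<in>{1..q}. l' j) = real r"
        "(\<Sum>j\<in>{1..q}. l' j *\<^sub>R vec (m j)) = y"
      unfolding L_def by blast
    have "(\<Sum>j\<in>{1..q}. s * l j + t * l' j) = (s + t) * real r"
      by (simp only: sum.distrib sum_distrib_left [symmetric] l l' distrib_right)
    moreover have "(\<Sum>j\<in>{1..q}. (s * l j + t * l' j) *\<^sub>R vec (m j)) = s *\<^sub>R x + t *\<^sub>R y"
      unfolding l(3) [symmetric] l'(3) [symmetric]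
      by (simp add: scaleR_add_left sum.distrib scaleR_sum_right)
    ultimately show "s *\<^sub>R x + t *\<^sub>R y \<in> L"
      unfolding L_def using st l(1) l'(1) by (intro CollectI exI [of _ "\<lambda>j. s * l j + t * l' j"]) auto
  qed
  moreover have "real r *\<^sub>R vec (m i) \<in> L" if "i \<in> {1..q}" for i
    unfolding L_def using that
    by (intro CollectI exI [of _ "\<lambda>j. if j = i then real r else 0"])
      (simp add: sum.delta if_distrib [where f = "\<lambda>x. x *\<^sub>R _"] cong: if_cong)
  ultimately have "K \<subseteq> L"
    unfolding K_def by (intro hull_minimal) auto
  have "vec e \<notin> P"
  proof
    assume "vec e \<in> P"
    then obtain x y where "vec e = x + y" "x \<in> L" "y \<in> C"
      using \<open>K \<subseteq> L\<close> unfolding P_def by auto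
    then obtain l where l: "\<forall>j\<in>{1..q}. 0 \<le> l j" "(\<Sum>j\<in>{1..q}. l j) = real r"
        "(\<Sum>j\<in>{1..q}. l j *\<^sub>R vec (m j)) = x"
      unfolding L_def by blast
    have "(\<Sum>j\<in>{1..q}. l j * real (Poly_Mapping.lookup (m j) k)) \<le> real (Poly_Mapping.lookup e k)" for k
    proof -
      have "real (Poly_Mapping.lookup e k) = x $ k + y $ k"
        using arg_cong [OF \<open>vec e = x + y\<close>, of "\<lambda>v. v $ k"] by (simp add: vec_def)
      moreover have "x $ k = (\<Sum>j\<in>{1..q}. l j * real (Poly_Mapping.lookup (m j) k))"
        unfolding l(3) [symmetric] by (simp add: vec_def)
      ultimately show ?thesis using \<open>y \<in> C\<close> by (simp add: C_def)
    qed
    with l assms show False unfolding newton_def by blast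
  qed
  have "C = (\<Inter>k. {y. 0 \<le> y $ k})" by (auto simp: C_def)
  then have "closed C"
    by (auto intro!: closed_INT closed_Collect_le continuous_intros)
  have "convex C" by (rule convexI) (simp add: C_def)
  have "convex P" "closed P"
    unfolding P_def using \<open>convex C\<close> \<open>closed C\<close>
    by (auto intro!: convex_sums compact_closed_sums finite_imp_compact_convex_hull simp: K_def)
  then obtain a b where ab: "inner a (vec e) < b" "\<And>x. x \<in> P \<Longrightarrow> b < inner a x"
    using separating_hyperplane_closed_point \<open>vec e \<notin> P\<close> by metis
  have inner: "inner a (vec u) = (\<Sum>k\<in>UNIV. a $ k * real (Poly_Mapping.lookup u k))" for u
    by (simp add: inner_vec_def vec_def)
  show ?thesis
  proof
    show "(\<Sum>k\<in>UNIV. a $ k * real (Poly_Mapping.lookup e k)) < b" using ab(1) by (simp add: inner)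
    fix i u assume i: "i \<ge> 1" and u: "power_exp q m (r * i) u"
    then obtain \<mu> where \<mu>: "(\<Sum>j\<in>{1..q}. \<mu> j) = r * i"
      "\<And>k. (\<Sum>j\<in>{1..q}. \<mu> j * Poly_Mapping.lookup (m j) k) \<le> Poly_Mapping.lookup u k"
      unfolding power_exp_def by blast
    define x where "x = (\<Sum>j\<in>{1..q}. (real (\<mu> j) / real (r * i)) *\<^sub>R (real r *\<^sub>R vec (m j)))"
    have "(\<Sum>j\<in>{1..q}. real (\<mu> j) / real (r * i)) = 1"
      using \<mu>(1) i r by (simp flip: sum_divide_distrib of_nat_sum)
    then have "x \<in> K"
      unfolding x_def K_def by (intro convex_sum convex_convex_hull hull_inc imageI) auto
    have x: "real i * x $ k = real (\<Sum>j\<in>{1..q}. \<mu> j * Poly_Mapping.lookup (m j) k)" for k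
      unfolding x_def vec_def using i r by (simp add: sum_distrib_left)
    have "real i * (x $ k) \<le> real (Poly_Mapping.lookup u k)" for k
      unfolding x using \<mu>(2) by (simp only: of_nat_le_iff)
    then have "(1 / real i) *\<^sub>R vec u - x \<in> C"
      using i by (simp add: C_def vec_def field_simps)
    with \<open>x \<in> K\<close> have "x + ((1 / real i) *\<^sub>R vec u - x) \<in> P" unfolding P_def by blast
    then have "b < inner a (vec u) / real i" using ab(2) by fastforce
    then show "real i * b < (\<Sum>k\<in>UNIV. a $ k * real (Poly_Mapping.lookup u k))"
      using i by (simp add: inner field_simps)
  qed
qed

text \<open>Suppose some exponent of \<open>p\<close> lies outside the polyhedron, and let \<open>w\<close> be the separating weight.
  In an equation \<open>p\<^sup>n + \<Sum>i. a\<^sub>i p\<^sup>n\<^sup>-\<^sup>i = 0\<close> every exponent of \<open>a\<^sub>i p\<^sup>n\<^sup>-\<^sup>i\<close> with \<open>i \<ge> 1\<close> has weight larger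
  than \<open>n c\<close>, where \<open>c\<close> is the least weight in \<open>p\<close>, while \<open>p\<^sup>n\<close> does have an exponent of weight \<open>n c\<close>.\<close>

lemma keys_integral_closure_newton:
  fixes m :: "nat \<Rightarrow> 'x::finite \<Rightarrow>\<^sub>0 nat" and p :: "('x, 'k::field) mpoly"
  assumes p: "p \<in> integral_closure (monomial_power q m r)" and "e0 \<in> Poly_Mapping.keys p"
  shows "newton q m r e0"
proof (rule ccontr)
  assume "\<not> newton q m r e0"
  then obtain v b where vb: "(\<Sum>k\<in>UNIV. v k * real (Poly_Mapping.lookup e0 k)) < b"
    "\<And>i u. i \<ge> 1 \<Longrightarrow> power_exp q m (r * i) u \<Longrightarrow>
       real i * b < (\<Sum>k\<in>UNIV. v k * real (Poly_Mapping.lookup u k))"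
    by (rule newton_separation) blast
  define w where "w u = (\<Sum>k\<in>UNIV. v k * real (Poly_Mapping.lookup u k))" for u
  have w_add: "w (x + y) = w x + w y" for x y
    by (simp add: w_def lookup_add distrib_left sum.distrib)
  have w_mult: "w (exp_mult n x) = real n * w x" for n x
    by (simp add: w_def lookup_exp_mult sum_distrib_left mult.left_commute)
  define dot where "dot x y = (\<Sum>k\<in>UNIV. Poly_Mapping.lookup x k * Poly_Mapping.lookup y k)"
    for x y :: "'x \<Rightarrow>\<^sub>0 nat"
  define c where "c = Min (w ` Poly_Mapping.keys p)"
  have c_le: "c \<le> w u" if "u \<in> Poly_Mapping.keys p" for u
    using that by (simp add: c_def)
  have "c < b" using c_le [OF assms(2)] vb(1) by (simp add: w_def)
  define F where "F = {u \<in> Poly_Mapping.keys p. w u = c}"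
  have "c \<in> w ` Poly_Mapping.keys p" unfolding c_def using assms(2) by (intro Min_in) auto
  then have "F \<noteq> {}" "finite F" by (auto simp: F_def)
  \<comment> \<open>Several exponents may share the least weight. By strict convexity, the one of maximal
    Euclidean norm is an extreme point of their convex hull, and \<open>R\<close> singles it out.\<close>
  then have "Max ((\<lambda>u. dot u u) ` F) \<in> (\<lambda>u. dot u u) ` F" by (intro Max_in) auto
  then obtain e where e: "e \<in> F" "dot e e = Max ((\<lambda>u. dot u u) ` F)" by auto
  have e_max: "dot u u \<le> dot e e" if "u \<in> F" for u
    unfolding e(2) using that \<open>finite F\<close> by (intro Max_ge) auto
  have dot_less: "dot e u < dot e e" if "u \<in> F" "u \<noteq> e" for u
  proof -
    obtain k where k: "Poly_Mapping.lookup u k \<noteq> Poly_Mapping.lookup e k"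
      using \<open>u \<noteq> e\<close> poly_mapping_eqI [of u e] by auto
    have "0 < (\<Sum>k\<in>UNIV. (int (Poly_Mapping.lookup u k) - int (Poly_Mapping.lookup e k))\<^sup>2)"
      by (rule sum_pos2 [of _ k]) (use k in auto)
    also have "\<dots> = int (dot u u) + int (dot e e) - 2 * int (dot e u)"
      by (simp add: dot_def power2_eq_square algebra_simps sum.distrib sum_subtractf sum_distrib_left)
    finally show ?thesis using e_max [OF that(1)] by linarith
  qed
  define R where "R d u \<longleftrightarrow> w d < w u \<or> w d = w u \<and> dot e u < dot e d" for d u
  have dot_add: "dot x (y + z) = dot x y + dot x z" for x y z
    by (simp add: dot_def lookup_add distrib_left sum.distrib)
  have least: "exp_mult n e \<in> Poly_Mapping.keys (p ^ n)
    \<and> (\<forall>u\<in>Poly_Mapping.keys (p ^ n). u = exp_mult n e \<or> R (exp_mult n e) u)" for n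
  proof (rule least_key_power [where R = R])
    show "e \<in> Poly_Mapping.keys p" using e by (simp add: F_def)
    show "u = e \<or> R e u" if "u \<in> Poly_Mapping.keys p" for u
      using c_le [OF that] dot_less [of u] that e(1) by (auto simp: F_def R_def)
  qed (auto simp: R_def w_add dot_add)
  have w_power: "real n * c \<le> w u" if "u \<in> Poly_Mapping.keys (p ^ n)" for u n
    using least [of n] that e(1) w_mult [of e n] by (auto simp: R_def F_def)
  obtain n a where n: "n \<ge> 1" and a: "\<And>i. i \<in> {1..n} \<Longrightarrow> a i \<in> monomial_power q m (r * i)"
    and eq: "p ^ n + (\<Sum>i=1..n. a i * p ^ (n - i)) = 0"
    using p unfolding integral_closure_def ideal_power_monomial_power by blast
  have "exp_mult n e \<in> Poly_Mapping.keys (- (p ^ n))" using least [of n] by (simp add: in_keys_iff)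
  moreover have "- (p ^ n) = (\<Sum>i=1..n. a i * p ^ (n - i))"
    using eq by (rule minus_unique)
  ultimately obtain i where i: "i \<in> {1..n}" "exp_mult n e \<in> Poly_Mapping.keys (a i * p ^ (n - i))"
    using keys_sum [of "\<lambda>i. a i * p ^ (n - i)" "{1..n}"] by fastforce
  then obtain x y where xy: "exp_mult n e = x + y" "x \<in> Poly_Mapping.keys (a i)"
      "y \<in> Poly_Mapping.keys (p ^ (n - i))"
    using keys_mult [of "a i" "p ^ (n - i)"] by auto
  have "power_exp q m (r * i) x" using a [OF i(1)] xy(2) by (simp add: monomial_power_def)
  then have "real i * b < w x" using vb(2) i by (simp add: w_def)
  moreover have "real i * c < real i * b" using \<open>c < b\<close> i by simp
  moreover have "real (n - i) * c \<le> w y" using w_power xy by blast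
  moreover have "w x + w y = real n * c"
    using w_mult [of e n] e(1) unfolding xy(1) w_add by (simp add: F_def)
  moreover have "real n * c = real i * c + real (n - i) * c"
    using i by (simp add: of_nat_diff algebra_simps)
  ultimately show False by linarith
qed

text \<open>This turns integral closedness into a rounding problem for real weights.\<close>

lemma integral_closure_monomial_power_eq_iff:
  fixes m :: "nat \<Rightarrow> 'x::finite \<Rightarrow>\<^sub>0 nat"
  shows "integral_closure (monomial_power q m r) = (monomial_power q m r :: ('x, 'k::field) mpoly set)
    \<longleftrightarrow> (\<forall>e. newton q m r e \<longrightarrow> power_exp q m r e)"
proof
  assume eq: "integral_closure (monomial_power q m r) = (monomial_power q m r :: ('x, 'k) mpoly set)"
  show "\<forall>e. newton q m r e \<longrightarrow> power_exp q m r e"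
  proof (intro allI impI)
    fix e assume "newton q m r e"
    from add_newton_monom_in_closure [OF this monomial_power_zero, where b = "1 :: ('x, 'k) mpoly"]
    show "power_exp q m r e" by (simp add: eq single_in_monomial_power_iff)
  qed
next
  assume *: "\<forall>e. newton q m r e \<longrightarrow> power_exp q m r e"
  show "integral_closure (monomial_power q m r) = (monomial_power q m r :: ('x, 'k) mpoly set)"
  proof
    show "integral_closure (monomial_power q m r) \<subseteq> (monomial_power q m r :: ('x, 'k) mpoly set)"
      using * keys_integral_closure_newton by (fastforce simp: monomial_power_def)
    show "(monomial_power q m r :: ('x, 'k) mpoly set) \<subseteq> integral_closure (monomial_power q m r)"
    proof
      fix p :: "('x, 'k) mpoly" assume p: "p \<in> monomial_power q m r"
      show "p \<in> integral_closure (monomial_power q m r)"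
        unfolding integral_closure_def ideal_power_monomial_power
        using p by (intro CollectI exI [of _ 1] conjI exI [of _ "\<lambda>_. - p"]) (auto intro: monomial_power_uminus)
    qed
  qed
qed

section \<open>Reduction to weights below one\<close>

text \<open>The set of indices of the generators divisible by \<open>x\<^sub>k\<close>. If nonempty, it is the index \<open>A\<close> of the one
  variable \<open>y\<^sub>A\<close> whose image under \<open>\<psi>\<^sub>I\<close> contains \<open>x\<^sub>k\<close>.\<close>

definition gens_at :: "nat \<Rightarrow> (nat \<Rightarrow> 'x \<Rightarrow>\<^sub>0 nat) \<Rightarrow> 'x \<Rightarrow> nat set" where
  "gens_at q m k = {j \<in> {1..q}. Poly_Mapping.lookup (m j) k \<noteq> 0}"

lemma gens_at_subset: "gens_at q m k \<subseteq> {1..q}"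
  by (auto simp: gens_at_def)

lemma finite_gens_at [simp]: "finite (gens_at q m k)"
  by (simp add: gens_at_def)

lemma lookup_squarefree:
  assumes "\<forall>j\<in>{1..q}. squarefree_exp (m j)" "j \<in> {1..q}"
  shows "Poly_Mapping.lookup (m j) k = of_bool (j \<in> gens_at q m k)"
proof -
  have "Poly_Mapping.lookup (m j) k \<le> 1"
    using assms by (simp add: squarefree_exp_def)
  then show ?thesis using assms(2) by (auto simp: gens_at_def)
qed

lemma sum_lookup_squarefree:
  fixes l :: "nat \<Rightarrow> 'a::semiring_1"
  assumes "\<forall>j\<in>{1..q}. squarefree_exp (m j)"
  shows "(\<Sum>j\<in>{1..q}. l j * of_nat (Poly_Mapping.lookup (m j) k)) = (\<Sum>j\<in>gens_at q m k. l j)"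
proof -
  have "(\<Sum>j\<in>{1..q}. l j * of_nat (Poly_Mapping.lookup (m j) k))
      = (\<Sum>j\<in>{1..q}. if j \<in> gens_at q m k then l j else 0)"
    using lookup_squarefree [OF assms] by (intro sum.cong) auto
  also have "\<dots> = (\<Sum>j\<in>gens_at q m k. l j)"
    using gens_at_subset [of q m k] by (simp add: sum.If_cases Int_absorb1)
  finally show ?thesis .
qed

lemma power_exp_subset:
  assumes sq: "\<forall>j\<in>{1..q}. squarefree_exp (m j)"
    and "U \<subseteq> {1..q}" "card U = r"
    and le: "\<And>k. card (gens_at q m k \<inter> U) \<le> Poly_Mapping.lookup e k"
  shows "power_exp q m r e"
  unfolding power_exp_def
proof (intro exI conjI allI)
  have "{1..q} \<inter> U = U" using assms by blast
  then show "(\<Sum>j\<in>{1..q}. of_bool (j \<in> U)) = r"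
    using assms by (simp add: of_bool_def sum.If_cases)
  show "(\<Sum>j\<in>{1..q}. of_bool (j \<in> U) * Poly_Mapping.lookup (m j) k) \<le> Poly_Mapping.lookup e k" for k
    using sum_lookup_squarefree [OF sq, of "\<lambda>j. of_bool (j \<in> U) :: nat" k] le [of k]
    by (simp add: of_bool_def sum.If_cases)
qed

text \<open>Splitting each weight into its integral and its fractional part splits off an honest product of
  generators.\<close>

lemma newton_fractional_part:
  assumes "newton q m r e"
  obtains d e' s r' l where "e = d + e'" "power_exp q m s d" "r = s + r'"
    "\<And>j. j \<in> {1..q} \<Longrightarrow> 0 \<le> l j" "\<And>j. j \<in> {1..q} \<Longrightarrow> l j < 1" "(\<Sum>j\<in>{1..q}. l j) = real r'"
    "\<And>k. (\<Sum>j\<in>{1..q}. l j * real (Poly_Mapping.lookup (m j) k)) \<le> real (Poly_Mapping.lookup e' k)"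
proof -
  obtain l :: "nat \<Rightarrow> real" where l: "\<And>j. j \<in> {1..q} \<Longrightarrow> 0 \<le> l j"
      "(\<Sum>j\<in>{1..q}. l j) = real r"
      "\<And>k. (\<Sum>j\<in>{1..q}. l j * real (Poly_Mapping.lookup (m j) k)) \<le> real (Poly_Mapping.lookup e k)"
    using assms unfolding newton_def by blast
  define \<mu> where "\<mu> j = nat \<lfloor>l j\<rfloor>" for j
  define s where "s = (\<Sum>j\<in>{1..q}. \<mu> j)"
  define d where "d = (\<Sum>j\<in>{1..q}. exp_mult (\<mu> j) (m j))"
  have d: "Poly_Mapping.lookup d k = (\<Sum>j\<in>{1..q}. \<mu> j * Poly_Mapping.lookup (m j) k)" for k
    by (simp add: d_def lookup_sum)
  have \<mu>: "real (\<mu> j) \<le> l j" "l j < real (\<mu> j) + 1" if "j \<in> {1..q}" for j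
    using l(1) [OF that] by (simp_all add: \<mu>_def)
  have "real s \<le> real r"
    unfolding s_def of_nat_sum l(2) [symmetric] using \<mu>(1) by (rule sum_mono)
  have d_le: "Poly_Mapping.lookup d k \<le> Poly_Mapping.lookup e k" for k
  proof -
    have "real (Poly_Mapping.lookup d k) \<le> (\<Sum>j\<in>{1..q}. l j * real (Poly_Mapping.lookup (m j) k))"
      unfolding d of_nat_sum of_nat_mult using \<mu>(1) by (intro sum_mono mult_right_mono) auto
    also note l(3)
    finally show ?thesis by simp
  qed
  show ?thesis
  proof
    show "e = d + (e - d)"
      using d_le by (intro poly_mapping_eqI) (simp add: lookup_add lookup_minus)
    show "power_exp q m s d" unfolding power_exp_def using d by (intro exI [of _ \<mu>]) (simp add: s_def)
    show "r = s + (r - s)" using \<open>real s \<le> real r\<close> by simp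
    show "0 \<le> l j - real (\<mu> j)" "l j - real (\<mu> j) < 1" if "j \<in> {1..q}" for j
      using \<mu> [OF that] by simp_all
    show "(\<Sum>j\<in>{1..q}. l j - real (\<mu> j)) = real (r - s)"
      using \<open>real s \<le> real r\<close> by (simp only: sum_subtractf l(2) of_nat_diff of_nat_le_iff) (simp add: s_def)
    show "(\<Sum>j\<in>{1..q}. (l j - real (\<mu> j)) * real (Poly_Mapping.lookup (m j) k))
        \<le> real (Poly_Mapping.lookup (e - d) k)" for k
      using l(3) [of k] d_le [of k] by (simp add: lookup_minus of_nat_diff d left_diff_distrib sum_subtractf)
  qed
qed

text \<open>Let \<open>T\<close> be the support of the weights. If \<open>r = 1\<close>, any generator in \<open>T\<close> divides \<open>x\<^sup>e\<close>: it is
  square-free, and each of its variables occurs in \<open>x\<^sup>e\<close> with positive exponent. If \<open>r = |T| - 1\<close>, the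
  product of all generators in \<open>T\<close> but one works: the complementary weights \<open>1 - l j\<close> are positive on
  \<open>T\<close> and add up to 1, so that rounding loses at most the omitted generator. Since all weights are
  below 1, \<open>r < |T|\<close> always holds when \<open>T\<close> is nonempty.\<close>

lemma fractional_power_exp:
  fixes l :: "nat \<Rightarrow> real"
  assumes sq: "\<forall>j\<in>{1..q}. squarefree_exp (m j)"
    and l: "\<And>j. j \<in> {1..q} \<Longrightarrow> 0 \<le> l j" "\<And>j. j \<in> {1..q} \<Longrightarrow> l j < 1"
    and sum: "(\<Sum>j\<in>{1..q}. l j) = real r"
    and le: "\<And>k. (\<Sum>j\<in>{1..q}. l j * real (Poly_Mapping.lookup (m j) k)) \<le> real (Poly_Mapping.lookup e k)"
    and r: "r \<le> 1 \<or> card {j \<in> {1..q}. 0 < l j} \<le> r + 1"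
  shows "power_exp q m r e"
proof (cases "r = 0")
  case True
  then show ?thesis by (simp add: power_exp_0)
next
  case False
  define T where "T = {j \<in> {1..q}. 0 < l j}"
  have "finite T" "T \<subseteq> {1..q}" by (auto simp: T_def)
  have restrict: "(\<Sum>j\<in>B. l j) = (\<Sum>j\<in>B \<inter> T. l j)" if "B \<subseteq> {1..q}" for B
  proof (rule sum.mono_neutral_right)
    show "finite B" using that finite_subset by blast
    show "\<forall>i\<in>B - B \<inter> T. l i = 0"
    proof
      fix i assume "i \<in> B - B \<inter> T"
      then have "i \<in> {1..q}" "\<not> 0 < l i" using that by (auto simp: T_def)
      then show "l i = 0" using l(1) [of i] by linarith
    qed
  qed auto
  have le': "(\<Sum>j\<in>gens_at q m k. l j) \<le> real (Poly_Mapping.lookup e k)" for k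
    using le [of k] sum_lookup_squarefree [OF sq, of l k] by simp
  have T_sum: "(\<Sum>j\<in>T. l j) = real r"
    using restrict [of "{1..q}"] sum \<open>T \<subseteq> {1..q}\<close> by (simp add: Int_absorb1)
  then have "T \<noteq> {}" using False by auto
  then obtain i where i: "i \<in> T" by blast
  then have iq: "i \<in> {1..q}" "0 < l i" by (auto simp: T_def)
  show ?thesis
  proof (cases "r = 1")
    case True
    show ?thesis
    proof (rule power_exp_subset [OF sq, of "{i}"])
      fix k
      show "card (gens_at q m k \<inter> {i}) \<le> Poly_Mapping.lookup e k"
      proof (cases "i \<in> gens_at q m k")
        case True
        have "0 < l i" by fact
        also have "l i \<le> (\<Sum>j\<in>gens_at q m k. l j)"
          using True l(1) gens_at_subset [of q m k] by (intro member_le_sum) auto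
        also note le'
        finally show ?thesis using True by simp
      qed simp
    qed (use iq True in auto)
  next
    case nr1: False
    have T_less: "l j < 1" if "j \<in> T" for j using that l(2) by (simp add: T_def)
    have "real r < (\<Sum>j\<in>T. 1)"
      unfolding T_sum [symmetric] using \<open>T \<noteq> {}\<close> \<open>finite T\<close> T_less by (intro sum_strict_mono) auto
    then have card_T: "card T = r + 1" using r False nr1 unfolding T_def [symmetric] by simp
    have defect: "(\<Sum>j\<in>T. 1 - l j) = 1"
      using T_sum card_T by (simp add: sum_subtractf)
    show ?thesis
    proof (rule power_exp_subset [OF sq, of "T - {i}"])
      fix k
      define B where "B = gens_at q m k \<inter> T"
      have B: "finite B" "B \<subseteq> T" by (auto simp: B_def)
      have B_sum: "real (card B) - (\<Sum>j\<in>B. 1 - l j) \<le> real (Poly_Mapping.lookup e k)"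
        using le' [of k] restrict [OF gens_at_subset, of m k] by (simp add: B_def sum_subtractf)
      show "card (gens_at q m k \<inter> (T - {i})) \<le> Poly_Mapping.lookup e k"
      proof (cases "i \<in> B")
        case True
        have "(\<Sum>j\<in>B. 1 - l j) \<le> (\<Sum>j\<in>T. 1 - l j)"
          using B \<open>finite T\<close> T_less by (intro sum_mono2) (auto intro: less_imp_le)
        also note defect
        finally have "(\<Sum>j\<in>B. 1 - l j) \<le> 1" .
        moreover have "gens_at q m k \<inter> (T - {i}) = B - {i}" by (auto simp: B_def)
        ultimately show ?thesis using B_sum True B by simp
      next
        case False
        have "(\<Sum>j\<in>B. 1 - l j) \<le> (\<Sum>j\<in>T - {i}. 1 - l j)"
          using B False \<open>finite T\<close> T_less by (intro sum_mono2) (auto intro: less_imp_le)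
        also have "\<dots> = l i"
          using defect i \<open>finite T\<close> by (simp add: sum_diff1)
        also have "\<dots> < 1" using T_less i .
        finally have "card B \<le> Poly_Mapping.lookup e k" using B_sum by linarith
        moreover have "gens_at q m k \<inter> (T - {i}) = B" using False i by (auto simp: B_def)
        ultimately show ?thesis by simp
      qed
    qed (use \<open>T \<subseteq> {1..q}\<close> i card_T in auto)
  qed
qed

text \<open>After the integral parts are split off, the remaining degree is smaller than the number of
  generators; degrees 0, 1 and \<open>q - 1\<close> are harmless, which leaves the range from 2 to \<open>q - 2\<close>.\<close>

theorem newton_imp_power_exp_by_reduction:
  assumes sq: "\<forall>j\<in>{1..q}. squarefree_exp (m j)"
    and closed: "\<And>r e. 2 \<le> r \<Longrightarrow> r \<le> q - 2 \<Longrightarrow> newton q m r e \<Longrightarrow> power_exp q m r e"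
    and "newton q m r e"
  shows "power_exp q m r e"
proof -
  obtain d e' s r' l where *: "e = d + e'" "power_exp q m s d" "r = s + r'"
    "\<And>j. j \<in> {1..q} \<Longrightarrow> 0 \<le> l j" "\<And>j. j \<in> {1..q} \<Longrightarrow> l j < 1" "(\<Sum>j\<in>{1..q}. l j) = real r'"
    "\<And>k. (\<Sum>j\<in>{1..q}. l j * real (Poly_Mapping.lookup (m j) k)) \<le> real (Poly_Mapping.lookup e' k)"
    by (rule newton_fractional_part [OF assms(3)]) (rule that)
  have "power_exp q m r' e'"
  proof (cases "2 \<le> r' \<and> r' \<le> q - 2")
    case True
    moreover have "newton q m r' e'" unfolding newton_def using * by blast
    ultimately show ?thesis using closed by blast
  next
    case False
    have "card {j \<in> {1..q}. 0 < l j} \<le> card {1..q}" by (intro card_mono) auto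
    with False have "r' \<le> 1 \<or> card {j \<in> {1..q}. 0 < l j} \<le> r' + 1" by auto
    with fractional_power_exp [OF sq *(4-7)] show ?thesis by blast
  qed
  with * power_exp_add show ?thesis by blast
qed

section \<open>The monomial \<open>\<psi>\<^sub>I(g(r, q))\<close>\<close>

definition g_exp :: "nat \<Rightarrow> (nat \<Rightarrow> 'x::finite \<Rightarrow>\<^sub>0 nat) \<Rightarrow> nat \<Rightarrow> ('x \<Rightarrow>\<^sub>0 nat)" where
  "g_exp q m r = (\<Sum>k\<in>UNIV. Poly_Mapping.single k (of_bool (gens_at q m k \<noteq> {}) +
     of_bool (3 \<le> card (gens_at q m k)) + (r - 2) * of_bool (1 \<in> gens_at q m k)))"

lemma lookup_sum_single:
  fixes f :: "'x::finite \<Rightarrow> nat"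
  shows "Poly_Mapping.lookup (\<Sum>k\<in>UNIV. Poly_Mapping.single k (f k)) k = f k"
  by (simp add: lookup_sum lookup_single when_def)

lemma poly_subst_prod: "poly_subst f (\<Prod>a\<in>A. h a) = (\<Prod>a\<in>A. poly_subst f (h a))"
  using poly_subst_Const [of f 1]
  by (induction A rule: infinite_finite_induct) (simp_all add: poly_subst_mult)

lemma poly_subst_power: "poly_subst f (p ^ n) = poly_subst f p ^ n"
  using poly_subst_prod [of f "\<lambda>_. p" "{..<n}"] by simp

lemma psi_prod_y_var:
  fixes m :: "nat \<Rightarrow> 'x::finite \<Rightarrow>\<^sub>0 nat"
  assumes "F \<subseteq> Pow {1..q}"
  shows "psi q m (\<Prod>A\<in>F. y_var A) =
    (monom (\<Sum>k\<in>UNIV. Poly_Mapping.single k (of_bool (gens_at q m k \<in> F))) :: ('x, 'k::field) mpoly)"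
proof -
  have "finite F" using assms by (rule finite_subset) simp
  have prod_Var: "(\<Prod>k\<in>K. Var k :: ('x, 'k) mpoly) = monom (\<Sum>k\<in>K. Poly_Mapping.single k 1)" for K
    by (induction K rule: infinite_finite_induct) (simp_all add: Var_def mult_single)
  have "psi q m (\<Prod>A\<in>F. y_var A) = (\<Prod>A\<in>F. \<Prod>k | \<forall>j\<in>{1..q}. (Var k :: ('x, 'k) mpoly) dvd monom (m j) \<longleftrightarrow> j \<in> A. Var k :: ('x, 'k) mpoly)"
    by (simp only: psi_def poly_subst_prod poly_subst_Var)
  also have "\<dots> = (\<Prod>A\<in>F. \<Prod>k | k \<in> {k. gens_at q m k \<in> F} \<and> gens_at q m k = A. Var k)"
  proof (intro prod.cong refl)
    fix A assume "A \<in> F"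
    then have "A \<subseteq> {1..q}" using assms by blast
    then have eq: "gens_at q m k = A \<longleftrightarrow> (\<forall>j\<in>{1..q}. (Var k :: ('x, 'k) mpoly) dvd monom (m j) \<longleftrightarrow> j \<in> A)" for k
      unfolding Var_dvd_monom_iff gens_at_def by auto
    then show "{k. \<forall>j\<in>{1..q}. (Var k :: ('x, 'k) mpoly) dvd monom (m j) \<longleftrightarrow> j \<in> A}
        = {k \<in> {k. gens_at q m k \<in> F}. gens_at q m k = A}"
      using \<open>A \<in> F\<close> by (simp only: mem_Collect_eq flip: eq) blast
  qed
  also have "\<dots> = (\<Prod>k\<in>{k. gens_at q m k \<in> F}. Var k)"
    using \<open>finite F\<close> by (intro prod.group) auto
  also have "\<dots> = monom (\<Sum>k\<in>{k. gens_at q m k \<in> F}. Poly_Mapping.single k 1)"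
    by (rule prod_Var)
  also have "(\<Sum>k\<in>{k. gens_at q m k \<in> F}. Poly_Mapping.single k (1::nat))
      = (\<Sum>k\<in>UNIV. Poly_Mapping.single k (of_bool (gens_at q m k \<in> F)))"
    by (rule sum.mono_neutral_cong_left) auto
  finally show ?thesis .
qed

lemma psi_g_elem:
  fixes m :: "nat \<Rightarrow> 'x::finite \<Rightarrow>\<^sub>0 nat"
  assumes "q \<ge> 1"
  shows "psi q m (g_elem r q) = (monom (g_exp q m r) :: ('x, 'k::field) mpoly)"
proof -
  have nonempty: "gens_at q m k \<in> {A. A \<subseteq> {1..q} \<and> 1 \<le> card A} \<longleftrightarrow> gens_at q m k \<noteq> {}" for k
    using gens_at_subset [of q m k] by (auto simp: Suc_le_eq card_gt_0_iff)
  have three: "gens_at q m k \<in> {A. A \<subseteq> {1..q} \<and> 3 \<le> card A} \<longleftrightarrow> 3 \<le> card (gens_at q m k)" for k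
    using gens_at_subset [of q m k] by auto
  have one: "gens_at q m k \<in> {A. A \<subseteq> {1..q} \<and> 1 \<in> A} \<longleftrightarrow> 1 \<in> gens_at q m k" for k
    using gens_at_subset [of q m k] by auto
  let ?mon = "\<lambda>f. monom (\<Sum>k\<in>UNIV. Poly_Mapping.single k (f k :: nat)) :: ('x, 'k) mpoly"
  have "psi q m (g_elem r q) = psi q m (\<Prod>A | A \<subseteq> {1..q} \<and> card A \<ge> 1. y_var A)
         * psi q m (\<Prod>A | A \<subseteq> {1..q} \<and> card A \<ge> 3. y_var A)
         * (psi q m (\<Prod>A | A \<subseteq> {1..q} \<and> 1 \<in> A. y_var A) :: ('x, 'k) mpoly) ^ (r - 2)"
    unfolding g_elem_def eps_def psi_def poly_subst_mult poly_subst_power ..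
  also have "\<dots> = ?mon (\<lambda>k. of_bool (gens_at q m k \<noteq> {})) *
      ?mon (\<lambda>k. of_bool (3 \<le> card (gens_at q m k))) *
      ?mon (\<lambda>k. of_bool (1 \<in> gens_at q m k)) ^ (r - 2)"
    by (subst (1 2 3) psi_prod_y_var) (blast, blast, blast, simp only: nonempty three one)
  also have "\<dots> = monom (g_exp q m r)"
    unfolding monom_power mult_single
    by (intro arg_cong2 [where f = Poly_Mapping.single] poly_mapping_eqI)
      (simp_all only: lookup_add lookup_exp_mult lookup_sum_single g_exp_def mult_1_left)
  finally show ?thesis .
qed

text \<open>Weight \<open>1/2\<close> on each of the first four generators and additional weight \<open>r - 2\<close> on the first. A
  variable that divides at most two of these four generators is charged at most 1 by the halves, and
  otherwise at most 2.\<close>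

lemma newton_g_exp:
  fixes m :: "nat \<Rightarrow> 'x::finite \<Rightarrow>\<^sub>0 nat"
  assumes sq: "\<forall>j\<in>{1..q}. squarefree_exp (m j)" and "q \<ge> 4" "r \<ge> 2"
  shows "newton q m r (g_exp q m r)"
  unfolding newton_def
proof (intro exI conjI allI ballI)
  let ?l = "\<lambda>j::nat. (if j \<in> {1..4} then 1 / 2 else 0) + (if j = 1 then real (r - 2) else 0)"
  have sums: "(\<Sum>j\<in>B. ?l j) = real (card (B \<inter> {1..4})) / 2 + real (r - 2) * of_bool (1 \<in> B)"
    if "finite B" for B
    using that by (simp only: sum.distrib sum.If_cases sum.delta Collect_mem_eq) (simp add: of_bool_def)
  show "0 \<le> ?l j" for j by simp
  have "{1..q} \<inter> {1..4} = {1..4::nat}" using \<open>q \<ge> 4\<close> by auto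
  then show "(\<Sum>j\<in>{1..q}. ?l j) = real r"
    using assms(2,3) by (subst sums) (auto simp: of_nat_diff)
  fix k
  define B where "B = gens_at q m k"
  have "card (B \<inter> {1..4}) \<le> card {1..4::nat}" "card (B \<inter> {1..4}) \<le> card B"
    by (intro card_mono; simp add: B_def)+
  moreover have "B = {} \<longrightarrow> card B = 0" by simp
  ultimately have "card (B \<inter> {1..4}) \<le> 2 * (of_bool (B \<noteq> {}) + of_bool (3 \<le> card B))"
    by (auto simp: of_bool_def)
  then have "real (card (B \<inter> {1..4})) \<le> real (2 * (of_bool (B \<noteq> {}) + of_bool (3 \<le> card B)))"
    by (simp only: of_nat_le_iff)
  then have "(\<Sum>j\<in>B. ?l j) \<le> real (Poly_Mapping.lookup (g_exp q m r) k)"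
    unfolding g_exp_def lookup_sum_single B_def [symmetric] by (subst sums) (simp_all add: B_def)
  then show "(\<Sum>j\<in>{1..q}. ?l j * real (Poly_Mapping.lookup (m j) k)) \<le> real (Poly_Mapping.lookup (g_exp q m r) k)"
    using sum_lookup_squarefree [OF sq, of ?l k] by (simp add: B_def)
qed

text \<open>If \<open>x\<^sup>e\<close> is integral over the square but not in it, the reduction above leaves only weights
  strictly between 0 and 1 on all four generators, with sum 2. Such weights have positive sum on a
  nonempty set, and on a set of at least three generators their sum exceeds 1, because the missing
  one has weight less than 1. Rounding up gives the exponent of \<open>\<psi>\<^sub>I(g(2, 4))\<close>.\<close>

lemma g_exp_le:
  fixes m :: "nat \<Rightarrow> 'x::finite \<Rightarrow>\<^sub>0 nat"
  assumes sq: "\<forall>j\<in>{1..4}. squarefree_exp (m j)"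
    and "newton 4 m 2 e" "\<not> power_exp 4 m 2 e"
  shows "Poly_Mapping.lookup (g_exp 4 m 2) k \<le> Poly_Mapping.lookup e k"
proof -
  obtain d e' s r' l where *: "e = d + e'" "power_exp 4 m s d" "2 = s + r'"
    "\<And>j. j \<in> {1..4} \<Longrightarrow> 0 \<le> l j" "\<And>j. j \<in> {1..4} \<Longrightarrow> l j < 1" "(\<Sum>j\<in>{1..4}. l j) = real r'"
    "\<And>k. (\<Sum>j\<in>{1..4}. l j * real (Poly_Mapping.lookup (m j) k)) \<le> real (Poly_Mapping.lookup e' k)"
    by (rule newton_fractional_part [OF assms(2)]) (rule that)
  define T where "T = {j \<in> {1..4}. 0 < l j}"
  have "\<not> power_exp 4 m r' e'"
    using * power_exp_add assms(3) by metis
  with fractional_power_exp [OF sq *(4-7)] have "\<not> r' \<le> 1" "\<not> card T \<le> r' + 1"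
    unfolding T_def by blast+
  then have r': "r' = 2" and "3 < card T" using *(3) by auto
  have "T = {1..4}"
    by (rule card_seteq) (use \<open>3 < card T\<close> in \<open>auto simp: T_def\<close>)
  then have pos: "0 < l j" if "j \<in> {1..4}" for j using that unfolding T_def by blast
  define B where "B = gens_at 4 m k"
  have B: "finite B" "B \<subseteq> {1..4}" unfolding B_def by (rule finite_gens_at, rule gens_at_subset)
  have le: "(\<Sum>j\<in>B. l j) \<le> real (Poly_Mapping.lookup e' k)"
    using *(7) [of k] sum_lookup_squarefree [OF sq, of l k] by (simp add: B_def)
  have "of_bool (B \<noteq> {}) + of_bool (3 \<le> card B) \<le> Poly_Mapping.lookup e' k"
  proof (cases "3 \<le> card B")
    case True
    have "(\<Sum>j\<in>{1..4} - B. l j) < 1"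
    proof (cases "{1..4} - B = {}")
      case False
      then obtain i where i: "i \<in> {1..4} - B" by blast
      have "card ({1..4} - B) \<le> 1" using True B by (subst card_Diff_subset) auto
      then have "{1..4} - B = {i}" using i by (metis card_le_Suc0_iff_eq One_nat_def finite_Diff finite_atLeastAtMost is_singletonI' is_singleton_def singletonD empty_iff)
      moreover have "l i < 1" using *(5) i by blast
      ultimately show ?thesis by simp
    next
      case True
      show ?thesis unfolding True by simp
    qed
    moreover have "(\<Sum>j\<in>{1..4} - B. l j) = 2 - (\<Sum>j\<in>B. l j)"
      using B *(6) r' by (subst sum_diff) auto
    ultimately have "1 < real (Poly_Mapping.lookup e' k)" using le by linarith
    then show ?thesis by simp
  next
    case False
    show ?thesis
    proof (cases "B = {}")
      case nonempty: False
      have "0 < (\<Sum>j\<in>B. l j)" using B pos nonempty by (intro sum_pos) auto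
      then have "0 < Poly_Mapping.lookup e' k" using le by linarith
      then show ?thesis using False by simp
    qed simp
  qed
  then show ?thesis
    unfolding g_exp_def lookup_sum_single B_def [symmetric] *(1) by (simp add: lookup_add)
qed

text \<open>For \<open>i \<noteq> j\<close>, the product \<open>m\<^sub>i m\<^sub>j\<close> exceeds \<open>\<psi>\<^sub>I(g(2, 4))\<close> exactly at a variable that divides \<open>m\<^sub>i\<close> and \<open>m\<^sub>j\<close> but
  no third generator. Conversely, if such a variable exists for every pair, any two multiplicities add
  up to at most 1, and then the four of them cannot add up to 2.\<close>

lemma power_exp_g_exp_iff:
  fixes m :: "nat \<Rightarrow> 'x::finite \<Rightarrow>\<^sub>0 nat"
  assumes sq: "\<forall>j\<in>{1..4}. squarefree_exp (m j)"
  shows "power_exp 4 m 2 (g_exp 4 m 2) \<longleftrightarrow>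
    (\<exists>i j. 1 \<le> i \<and> i < j \<and> j \<le> 4 \<and> (\<forall>k. gens_at 4 m k \<noteq> {i, j}))"
proof
  assume "power_exp 4 m 2 (g_exp 4 m 2)"
  then obtain \<mu> where \<mu>: "(\<Sum>j\<in>{1..4}. \<mu> j) = 2"
    "\<And>k. (\<Sum>j\<in>{1..4}. \<mu> j * Poly_Mapping.lookup (m j) k) \<le> Poly_Mapping.lookup (g_exp 4 m 2) k"
    unfolding power_exp_def by blast
  show "\<exists>i j. 1 \<le> i \<and> i < j \<and> j \<le> 4 \<and> (\<forall>k. gens_at 4 m k \<noteq> {i, j})"
  proof (rule ccontr)
    assume no: "\<not> ?thesis"
    have pair: "\<mu> i + \<mu> j \<le> 1" if ij: "1 \<le> i" "i < j" "j \<le> 4" for i j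
    proof -
      obtain k where k: "gens_at 4 m k = {i, j}" using no ij by blast
      show ?thesis
        using \<mu>(2) [of k] sum_lookup_squarefree [OF sq, of \<mu> k] k ij(2)
        unfolding g_exp_def lookup_sum_single by simp
    qed
    have "{1..4} = {1, 2, 3, 4::nat}" by auto
    then have "\<mu> 1 + \<mu> 2 + \<mu> 3 + \<mu> 4 = 2" using \<mu>(1) by simp
    with pair [of 1 2] pair [of 1 3] pair [of 1 4] pair [of 2 3] pair [of 2 4] pair [of 3 4]
    show False by presburger
  qed
next
  assume "\<exists>i j. 1 \<le> i \<and> i < j \<and> j \<le> 4 \<and> (\<forall>k. gens_at 4 m k \<noteq> {i, j})"
  then obtain i j where ij: "1 \<le> i" "i < j" "j \<le> 4" and no: "\<And>k. gens_at 4 m k \<noteq> {i, j}" by blast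
  show "power_exp 4 m 2 (g_exp 4 m 2)"
  proof (rule power_exp_subset [OF sq, of "{i, j}"])
    fix k
    define B where "B = gens_at 4 m k"
    have "finite B" by (simp add: B_def)
    have "card (B \<inter> {i, j}) \<le> of_bool (B \<noteq> {}) + of_bool (3 \<le> card B)"
    proof (cases "{i, j} \<subseteq> B")
      case True
      then have "{i, j} \<subset> B" using no [of k] by (auto simp: B_def)
      then have "card {i, j} < card B" using \<open>finite B\<close> by (rule psubset_card_mono [rotated])
      then have "3 \<le> card B" using ij(2) by simp
      moreover have "card (B \<inter> {i, j}) \<le> card {i, j}" by (intro card_mono) auto
      ultimately show ?thesis using ij(2) by auto
    next
      case False
      then have "B \<inter> {i, j} \<subset> {i, j}" by blast
      then have "card (B \<inter> {i, j}) < card {i, j}" by (intro psubset_card_mono) auto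
      then show ?thesis using ij(2) by (cases "B = {}") auto
    qed
    then show "card (gens_at 4 m k \<inter> {i, j}) \<le> Poly_Mapping.lookup (g_exp 4 m 2) k"
      unfolding g_exp_def lookup_sum_single B_def by simp
  qed (use ij in auto)
qed

lemma psi_y_var_eq_1_iff:
  fixes m :: "nat \<Rightarrow> 'x::finite \<Rightarrow>\<^sub>0 nat"
  assumes "A \<subseteq> {1..q}"
  shows "psi q m (y_var A) = (1 :: ('x, 'k::field) mpoly) \<longleftrightarrow> (\<forall>k. gens_at q m k \<noteq> A)"
proof -
  let ?s = "\<Sum>k\<in>UNIV. Poly_Mapping.single k (of_bool (gens_at q m k = A) :: nat)"
  have "psi q m (y_var A) = (monom ?s :: ('x, 'k) mpoly)"
    using psi_prod_y_var [of "{A}" q m] assms by simp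
  also have "\<dots> = 1 \<longleftrightarrow> ?s = 0"
  proof
    assume "monom ?s = (1 :: ('x, 'k) mpoly)"
    from arg_cong [OF this, of Poly_Mapping.keys] show "?s = 0" by (simp only: keys_single keys_one) simp
  qed simp
  also have "\<dots> \<longleftrightarrow> (\<forall>k. Poly_Mapping.lookup ?s k = 0)"
    by (auto simp only: poly_mapping_eq_iff fun_eq_iff lookup_zero)
  finally show ?thesis unfolding lookup_sum_single by simp
qed

text \<open>A variable violates the divisibility exactly if it divides \<open>m\<^sub>a\<close> and \<open>m\<^sub>b\<close> but neither of the other two
  generators.\<close>

lemma gcd_dvd_lcm_iff:
  assumes sq: "\<forall>j\<in>{1..4}. squarefree_exp (m j)" and abcd: "{a, b, c, d} = {1, 2, 3, 4 :: nat}"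
  shows "(monom (exp_gcd (m a) (m b)) :: ('x, 'k::field) mpoly) dvd monom (exp_lcm (m c) (m d))
    \<longleftrightarrow> (\<forall>k. gens_at 4 m k \<noteq> {a, b})"
proof -
  have four: "{1, 2, 3, 4} = {1..4::nat}" by auto
  have mem: "a \<in> {1..4}" "b \<in> {1..4}" "c \<in> {1..4}" "d \<in> {1..4}"
    using abcd unfolding four by blast+
  have "card {a, b, c, d} = 4" unfolding abcd by simp
  then have distinct: "c \<notin> {a, b}" "d \<notin> {a, b}"
    by (auto simp: card_insert_if split: if_splits)
  have "Poly_Mapping.lookup (exp_gcd (m a) (m b)) k \<le> Poly_Mapping.lookup (exp_lcm (m c) (m d)) k
      \<longleftrightarrow> gens_at 4 m k \<noteq> {a, b}" for k
  proof -
    have "gens_at 4 m k \<subseteq> {a, b, c, d}" unfolding abcd four by (rule gens_at_subset)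
    then have "gens_at 4 m k = {a, b} \<longleftrightarrow>
        a \<in> gens_at 4 m k \<and> b \<in> gens_at 4 m k \<and> c \<notin> gens_at 4 m k \<and> d \<notin> gens_at 4 m k"
      using distinct by blast
    then show ?thesis
      unfolding exp_gcd.rep_eq exp_lcm.rep_eq mem [THEN lookup_squarefree [OF sq]] by auto
  qed
  then show ?thesis by (simp add: monom_dvd_monom_iff)
qed

text \<open>Only the unordered pair \<open>{a, b}\<close> matters, and the other two indices are determined by it up to
  order.\<close>

lemma ex_pair_iff_ex_split:
  assumes "\<And>a b c d. {a, b, c, d} = {1, 2, 3, 4 :: nat} \<Longrightarrow> Q a b c d \<longleftrightarrow> P {a, b}"
  shows "(\<exists>i j. 1 \<le> i \<and> i < j \<and> j \<le> 4 \<and> P {i, j}) \<longleftrightarrow>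
    (\<exists>a b c d. {a, b, c, d} = {1, 2, 3, 4 :: nat} \<and> Q a b c d)"
proof
  assume "\<exists>i j. 1 \<le> i \<and> i < j \<and> j \<le> 4 \<and> P {i, j}"
  then obtain i j where ij: "1 \<le> i" "i < j" "j \<le> (4::nat)" and P: "P {i, j}" by blast
  have "card ({1, 2, 3, 4} - {i, j}) = 2"
    using ij by (subst card_Diff_subset) auto
  then obtain c d where "{1, 2, 3, 4} - {i, j} = {c, d}" by (auto simp: card_2_iff)
  moreover have "{i, j} \<subseteq> {1, 2, 3, 4}" using ij by auto
  ultimately have "{i, j, c, d} = {1, 2, 3, 4}" by blast
  with assms [OF this] P show "\<exists>a b c d. {a, b, c, d} = {1, 2, 3, 4} \<and> Q a b c d" by auto
next
  assume "\<exists>a b c d. {a, b, c, d} = {1, 2, 3, 4} \<and> Q a b c d"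
  then obtain a b c d where abcd: "{a, b, c, d} = {1, 2, 3, 4 :: nat}" and "Q a b c d" by blast
  have "{min a b, max a b} = {a, b}" by (auto simp: min_def max_def)
  with assms [OF abcd] \<open>Q a b c d\<close> have P: "P {min a b, max a b}" by simp
  have "card {a, b, c, d} = 4" unfolding abcd by simp
  then have "a \<noteq> b" by (auto simp: card_insert_if split: if_splits)
  moreover have "a \<in> {1, 2, 3, 4}" "b \<in> {1, 2, 3, 4}" using abcd by blast+
  ultimately have "1 \<le> min a b" "min a b < max a b" "max a b \<le> 4" by auto
  with P show "\<exists>i j. 1 \<le> i \<and> i < j \<and> j \<le> 4 \<and> P {i, j}" by blast
qed

lemma integral_closure_square_four:
  fixes m :: "nat \<Rightarrow> 'x::finite \<Rightarrow>\<^sub>0 nat"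
  assumes sq: "\<forall>j\<in>{1..4}. squarefree_exp (m j)"
  shows "integral_closure (monomial_power 4 m 2) =
    ideal_sum (monomial_power 4 m 2) (ideal_gen {monom (g_exp 4 m 2) :: ('x, 'k::field) mpoly})"
proof
  let ?g = "monom (g_exp 4 m 2) :: ('x, 'k) mpoly"
  have gen: "ideal_gen {?g} = range (\<lambda>b. b * ?g)"
    unfolding ideal_gen_def by (rule module.span_singleton [OF module_times])
  show "ideal_sum (monomial_power 4 m 2) (ideal_gen {?g}) \<subseteq> integral_closure (monomial_power 4 m 2)"
    using add_newton_monom_in_closure [OF newton_g_exp [OF sq]] by (auto simp: ideal_sum_def gen)
  show "integral_closure (monomial_power 4 m 2) \<subseteq> ideal_sum (monomial_power 4 m 2) (ideal_gen {?g})"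
  proof
    fix p :: "('x, 'k) mpoly" assume p: "p \<in> integral_closure (monomial_power 4 m 2)"
    define E where "E = {e \<in> Poly_Mapping.keys p. power_exp 4 m 2 e}"
    let ?t = "\<lambda>e. Poly_Mapping.single e (Poly_Mapping.lookup p e)"
    define b where "b = (\<Sum>e\<in>Poly_Mapping.keys p - E.
      Poly_Mapping.single (e - g_exp 4 m 2) (Poly_Mapping.lookup p e))"
    have "?t e = Poly_Mapping.single (e - g_exp 4 m 2) (Poly_Mapping.lookup p e) * ?g"
      if e: "e \<in> Poly_Mapping.keys p - E" for e
    proof -
      have "newton 4 m 2 e" "\<not> power_exp 4 m 2 e"
        using e keys_integral_closure_newton [OF p] by (auto simp: E_def)
      from g_exp_le [OF sq this] have "e = (e - g_exp 4 m 2) + g_exp 4 m 2"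
        by (intro poly_mapping_eqI) (simp add: lookup_add lookup_minus)
      then show ?thesis by (simp add: mult_single)
    qed
    then have "(\<Sum>e\<in>Poly_Mapping.keys p - E. ?t e) = b * ?g"
      by (simp add: b_def sum_distrib_right)
    moreover have "p = (\<Sum>e\<in>Poly_Mapping.keys p - E. ?t e) + (\<Sum>e\<in>E. ?t e)"
      by (subst poly_eq_sum_single) (intro sum.subset_diff, auto simp: E_def)
    ultimately have "p = (\<Sum>e\<in>E. ?t e) + b * ?g" by (simp only: add.commute)
    moreover have "(\<Sum>e\<in>E. ?t e) \<in> monomial_power 4 m 2"
      by (intro monomial_power_sum) (simp add: E_def single_in_monomial_power_iff)
    ultimately show "p \<in> ideal_sum (monomial_power 4 m 2) (ideal_gen {?g})"
      unfolding ideal_sum_def gen by blast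
  qed
qed

theorem theorem3p16:
  fixes I :: "('n::finite, 'k::field) mpoly set"
    and q :: nat
    and m :: "nat \<Rightarrow> 'n \<Rightarrow>\<^sub>0 nat"
  assumes "q \<ge> 1"
    and "\<forall>j\<in>{1..q}. squarefree_exp (m j)"
    and "minimal_monomial_generators I q m"
  shows
    "(\<forall>r. q \<ge> 4 \<and> r \<ge> 2 \<and> psi q m (g_elem r q) \<notin> ideal_power I r \<longrightarrow>
        integral_closure (ideal_power I r) \<noteq> ideal_power I r)
   \<and> (q \<le> 3 \<longrightarrow> normal_ideal I)
   \<and> (q = 4 \<longrightarrow> integral_closure (ideal_power I 2)
        = ideal_sum (ideal_power I 2) (ideal_gen {psi q m (g_elem 2 4)}))
   \<and> (q \<in> {4, 5} \<longrightarrow>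
        (normal_ideal I \<longleftrightarrow>
          (\<forall>r. 2 \<le> r \<and> r \<le> q - 2 \<longrightarrow>
            integral_closure (ideal_power I r) = ideal_power I r)))
   \<and> (q = 4 \<longrightarrow>
        (normal_ideal I \<longleftrightarrow> psi q m (g_elem 2 4) \<in> ideal_power I 2)
      \<and> (normal_ideal I \<longleftrightarrow>
          (\<exists>i j. 1 \<le> i \<and> i < j \<and> j \<le> 4 \<and> psi q m (y_var {i, j}) = (1 :: ('n, 'k) mpoly)))
      \<and> (normal_ideal I \<longleftrightarrow>
          (\<exists>a b c d. {a, b, c, d} = {1, 2, 3, 4 :: nat} \<and>
            (monom (exp_gcd (m a) (m b)) :: ('n, 'k) mpoly)
              dvd monom (exp_lcm (m c) (m d)))))"
proof -
  note sq = assms(2)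
  have "I = ideal_gen ((\<lambda>j. monom (m j)) ` {1..q})"
    using assms(3) by (simp add: minimal_monomial_generators_def)
  then have I: "ideal_power I r = monomial_power q m r" for r
    by (simp only: ideal_power_eq_monomial_power)
  have closed: "integral_closure (ideal_power I r) = ideal_power I r \<longleftrightarrow>
      (\<forall>e. newton q m r e \<longrightarrow> power_exp q m r e)" for r
    unfolding I by (rule integral_closure_monomial_power_eq_iff)
  have psi_g: "psi q m (g_elem r q) \<in> ideal_power I r \<longleftrightarrow> power_exp q m r (g_exp q m r)" for r
    unfolding I psi_g_elem [OF assms(1)] single_in_monomial_power_iff by simp
  have normal: "normal_ideal I \<longleftrightarrow> (\<forall>r. 2 \<le> r \<and> r \<le> q - 2 \<longrightarrow>
      integral_closure (ideal_power I r) = ideal_power I r)"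
    unfolding normal_ideal_def closed using newton_imp_power_exp_by_reduction [OF sq] by auto
  have 1: "\<forall>r. q \<ge> 4 \<and> r \<ge> 2 \<and> psi q m (g_elem r q) \<notin> ideal_power I r \<longrightarrow>
        integral_closure (ideal_power I r) \<noteq> ideal_power I r"
    unfolding closed psi_g using newton_g_exp [OF sq] by auto
  have 2: "q \<le> 3 \<longrightarrow> normal_ideal I"
    unfolding normal by auto
  have 3: "q = 4 \<longrightarrow> integral_closure (ideal_power I 2)
      = ideal_sum (ideal_power I 2) (ideal_gen {psi q m (g_elem 2 4)})"
  proof
    assume q: "q = 4"
    show "integral_closure (ideal_power I 2)
        = ideal_sum (ideal_power I 2) (ideal_gen {psi q m (g_elem 2 4)})"
      using integral_closure_square_four [OF sq [unfolded q]]
      unfolding I q by (simp only: psi_g_elem one_le_numeral)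
  qed
  have 4: "q \<in> {4, 5} \<longrightarrow> (normal_ideal I \<longleftrightarrow> (\<forall>r. 2 \<le> r \<and> r \<le> q - 2 \<longrightarrow>
      integral_closure (ideal_power I r) = ideal_power I r))"
    by (rule impI) (rule normal)
  have 5: "q = 4 \<longrightarrow>
        (normal_ideal I \<longleftrightarrow> psi q m (g_elem 2 4) \<in> ideal_power I 2)
      \<and> (normal_ideal I \<longleftrightarrow>
          (\<exists>i j. 1 \<le> i \<and> i < j \<and> j \<le> 4 \<and> psi q m (y_var {i, j}) = (1 :: ('n, 'k) mpoly)))
      \<and> (normal_ideal I \<longleftrightarrow>
          (\<exists>a b c d. {a, b, c, d} = {1, 2, 3, 4 :: nat} \<and>
            (monom (exp_gcd (m a) (m b)) :: ('n, 'k) mpoly)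
              dvd monom (exp_lcm (m c) (m d))))"
  proof
    assume q: "q = 4"
    note sq4 = sq [unfolded q]
    have "normal_ideal I \<longleftrightarrow> (\<forall>e. newton 4 m 2 e \<longrightarrow> power_exp 4 m 2 e)"
      unfolding normal closed q by (auto intro: order_antisym)
    also have "\<dots> \<longleftrightarrow> power_exp 4 m 2 (g_exp 4 m 2)"
    proof
      assume g: "power_exp 4 m 2 (g_exp 4 m 2)"
      show "\<forall>e. newton 4 m 2 e \<longrightarrow> power_exp 4 m 2 e"
      proof (intro allI impI, rule ccontr)
        fix e assume "newton 4 m 2 e" and no: "\<not> power_exp 4 m 2 e"
        from g_exp_le [OF sq4 this] have "e = g_exp 4 m 2 + (e - g_exp 4 m 2)"
          by (intro poly_mapping_eqI) (simp add: lookup_add lookup_minus)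
        with power_exp_mono [OF g] no show False by metis
      qed
    qed (use newton_g_exp [OF sq4] in auto)
    finally have a: "normal_ideal I \<longleftrightarrow> power_exp 4 m 2 (g_exp 4 m 2)" .
    have b: "psi q m (g_elem 2 4) \<in> ideal_power I 2 \<longleftrightarrow> power_exp 4 m 2 (g_exp 4 m 2)"
      using psi_g [of 2] unfolding q .
    have c: "(\<exists>i j. 1 \<le> i \<and> i < j \<and> j \<le> 4 \<and> psi q m (y_var {i, j}) = (1 :: ('n, 'k) mpoly))
        \<longleftrightarrow> power_exp 4 m 2 (g_exp 4 m 2)"
      unfolding q power_exp_g_exp_iff [OF sq4]
      by (intro ex_cong1 conj_cong refl psi_y_var_eq_1_iff) auto
    have d: "(\<exists>a b c d. {a, b, c, d} = {1, 2, 3, 4 :: nat} \<and>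
            (monom (exp_gcd (m a) (m b)) :: ('n, 'k) mpoly) dvd monom (exp_lcm (m c) (m d)))
        \<longleftrightarrow> power_exp 4 m 2 (g_exp 4 m 2)"
      unfolding power_exp_g_exp_iff [OF sq4]
      by (rule sym, rule ex_pair_iff_ex_split) (rule gcd_dvd_lcm_iff [OF sq4])
    show "(normal_ideal I \<longleftrightarrow> psi q m (g_elem 2 4) \<in> ideal_power I 2)
      \<and> (normal_ideal I \<longleftrightarrow>
          (\<exists>i j. 1 \<le> i \<and> i < j \<and> j \<le> 4 \<and> psi q m (y_var {i, j}) = (1 :: ('n, 'k) mpoly)))
      \<and> (normal_ideal I \<longleftrightarrow>
          (\<exists>a b c d. {a, b, c, d} = {1, 2, 3, 4 :: nat} \<and>
            (monom (exp_gcd (m a) (m b)) :: ('n, 'k) mpoly)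
              dvd monom (exp_lcm (m c) (m d))))"
      unfolding a b c d by simp
  qed
  show ?thesis
    by (rule conjI [OF 1 conjI [OF 2 conjI [OF 3 conjI [OF 4 5]]]])
qed

end
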